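(* The system of quantized chromatic ideals $\{\mathcal{I}_\Gamma\}$ is compatible with quantum cluster mutations: if $\Gamma,\Gamma'$ are regular cubic graphs on the sphere, with $2g+2$ vertices, related by a flip at an edge $e_0$, with quantum mutation isomorphism $\mu_0:\mathcal{T}_{\Gamma',\Gamma}\to\mathcal{T}_{\Gamma,\Gamma'}$ between localized quantum tori, then $$\mu_0(\mathcal{I}_{\Gamma',\Gamma})=\mathcal{I}_{\Gamma,\Gamma'}.$$
   Context: Let $\Gamma$ be a cubic graph embedded in the oriented sphere $S^2$ with $2g+2$ vertices, $3g+3$ edges and $g+3$ faces. Quantum torus: let $\Lambda_\Gamma=\mathbb{Z}^{E(\Gamma)}$ be the edge lattice with skew-symmetric form $(\cdot,\cdot)$ defined as a sum over vertices: each vertex at which edge $e$ immediately precedes edge $e'$ in the counterclockwise cyclic order contributes $+1$ to $(e,e')$ and $-1$ to $(e',e)$. The quantum torus $\mathcal{T}^q_\Gamma$ is the $\mathbb{C}[q^{\pm1}]$-algebra spanned by $X_v$, $v\in\Lambda_\Gamma$, with $X_vX_w=q^{(v,w)}X_{v+w}$. Chromatic ideal: $\mathcal{I}_\Gamma$ is the left ideal of $\mathcal{T}^q_\Gamma$ generated by the following elements. (1) For each face $f$ with edges $e_1,\dots,e_n$ in counterclockwise order: $X_{e_1+\cdots+e_n}-q^{-2}$. (2) $X_s-(-q)^{-(g+3)}$, where $s=\sum_{e\in E(\Gamma)}e$. (3) For each face $f$ as in (1): $R_f=q^{-1}+X_{e_1}+X_{e_1+e_2}+\cdots+X_{e_1+e_2+\cdots+e_{n-1}}$.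 (Modulo (1), the ideal does not depend on which edge of the face is called $e_1$.) Flip: suppose $e_0$ is an edge of $\Gamma$ which, drawn horizontally, has neighbouring edges $e_1$ (upper left), $e_2$ (lower left), $e_3$ (lower right), $e_4$ (upper right), with $e_0,\dots,e_4$ pairwise distinct; thus $e_0,e_1,e_2$ is the counterclockwise order at the left vertex and $e_0,e_3,e_4$ the counterclockwise order at the right vertex. The flipped graph $\Gamma'$ is obtained by replacing $e_0$ by a vertical edge (still denoted $e_0$) whose top vertex is incident to $e_1,e_4$ and whose bottom vertex is incident to $e_2,e_3$; all other edges are unchanged. Generators of $\mathcal{T}^q_{\Gamma'}$ are denoted $X'_v$. Localization: $\mathcal{T}_{\Gamma,\Gamma'}$ is the localization of $\mathcal{T}^q_\Gamma$ at the Ore set of finite products $\{\prod_{k\in\mathbb{Z}}(1+q^{2k+1}X_{e_0})^{n_k}: n_k\ge 0\}$, and $\mathcal{T}_{\Gamma',\Gamma}$ is the localization of $\mathcal{T}^q_{\Gamma'}$ at the analogous set with $X'_{e_0}$ in place of $X_{e_0}$. Quantum mutation: $\mu_0:\mathcal{T}_{\Gamma',\Gamma}\to\mathcal{T}_{\Gamma,\Gamma'}$ is the algebra isomorphism with $X'_{e_0}\mapsto X_{-e_0}$, $X'_{e_1}\mapsto X_{e_1}(1+qX_{e_0})$, $X'_{e_2}\mapsto X_{e_2}(1+qX_{-e_0})^{-1}$, $X'_{e_3}\mapsto X_{e_3}(1+qX_{e_0})$, $X'_{e_4}\mapsto X_{e_4}(1+qX_{-e_0})^{-1}$, and $X'_e\mapsto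 X_e$ for every other edge $e$. Finally $\mathcal{I}_{\Gamma,\Gamma'}$ is the left ideal of $\mathcal{T}_{\Gamma,\Gamma'}$ generated by $\mathcal{I}_\Gamma$, and $\mathcal{I}_{\Gamma',\Gamma}$ is the left ideal of $\mathcal{T}_{\Gamma',\Gamma}$ generated by $\mathcal{I}_{\Gamma'}$. *)

theory Defs
  imports
    Complex_Main
    "HOL-Library.Poly_Mapping"
    "HOL-Algebra.QuotRing"
    "HOL-Combinatorics.Orbits"
begin

section \<open>Cubic graphs on the oriented sphere\<close>

text \<open>
  A graph embedded in an oriented closed surface is encoded by its rotation system. The edge set
  is the finite type \<open>'e\<close>; every edge has two half-edges (darts) \<open>(e, False)\<close> and \<open>(e, True)\<close>,
  attached to its two ends. The rotation \<open>\<sigma>\<close> maps a dart to the next dart, in counterclockwise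
  order, at the same vertex, so vertices are the orbits of \<open>\<sigma>\<close>. Loops and multiple edges can be
  encoded.
\<close>

type_synonym 'e dart = "'e \<times> bool"
type_synonym 'e rotation = "'e dart \<Rightarrow> 'e dart"

definition opp :: "'e dart \<Rightarrow> 'e dart" where
  "opp d = (fst d, \<not> snd d)"

text \<open>
  A dart is also read as its edge directed away from the vertex of the dart. Travelling along \<open>d\<close>
  with a face on the left, one arrives at the far end on the dart \<open>opp d\<close> and turns left, i.e.
  continues along the dart that is next in clockwise order after \<open>opp d\<close>. The orbits of this map
  are the faces, each of them run through counterclockwise.
\<close>

definition face_step :: "'e rotation \<Rightarrow> 'e dart \<Rightarrow> 'e dart" where
  "face_step \<sigma> d = inv_into UNIV \<sigma> (opp d)"

definition vertices :: "'e rotation \<Rightarrow> 'e dart set set" where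
  "vertices \<sigma> = range (orbit \<sigma>)"

definition faces :: "'e rotation \<Rightarrow> 'e dart set set" where
  "faces \<sigma> = range (orbit (face_step \<sigma>))"

text \<open>
  For a connected rotation system with \<open>2g + 2\<close> vertices and \<open>3g + 3\<close> edges, having \<open>g + 3\<close> faces
  says that the Euler characteristic is 2, i.e. that the surface is the sphere.
\<close>

definition cubic_sphere_graph :: "nat \<Rightarrow> ('e::finite) rotation \<Rightarrow> bool" where
  "cubic_sphere_graph g \<sigma> \<longleftrightarrow>
     (\<forall>d. \<sigma> d \<noteq> d \<and> \<sigma> (\<sigma> (\<sigma> d)) = d) \<and>
     (\<forall>d d'. (d, d') \<in> (range (\<lambda>c. (c, \<sigma> c)) \<union> range (\<lambda>c. (c, opp c)))\<^sup>*) \<and>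
     card (vertices \<sigma>) = 2 * g + 2 \<and>
     card (UNIV :: 'e set) = 3 * g + 3 \<and>
     card (faces \<sigma>) = g + 3"

text \<open>
  Regularity: the two sides of an edge are different faces; equivalently, no edge of the
  triangulation dual to the graph is a loop, or: the edges \<open>e\<^sub>1, \<dots>, e\<^sub>n\<close> on the boundary of a face
  are pairwise distinct. Without it, the choice of the edge called \<open>e\<^sub>1\<close> would matter
  in the elements \<open>R\<^sub>f\<close> below.
\<close>

definition regular_graph :: "'e rotation \<Rightarrow> bool" where
  "regular_graph \<sigma> \<longleftrightarrow> (\<forall>d. orbit (face_step \<sigma>) d \<noteq> orbit (face_step \<sigma>) (opp d))"

text \<open>The edges of the face to the left of \<open>d\<close> in counterclockwise order, starting with that of \<open>d\<close>.\<close>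

definition face_edges :: "'e rotation \<Rightarrow> 'e dart \<Rightarrow> 'e list" where
  "face_edges \<sigma> d =
     map (\<lambda>i. fst ((face_step \<sigma> ^^ i) d)) [0..<card (orbit (face_step \<sigma>) d)]"

text \<open>
  The flip at \<open>e\<^sub>0\<close>: the darts \<open>l\<close>, \<open>r\<close> of \<open>e\<^sub>0\<close> sit at the left and the right vertex before the
  flip, and its darts \<open>t\<close>, \<open>b\<close> sit at the top and the bottom vertex after the flip. As an edge has
  no preferred direction, \<open>t\<close> may be either of the two darts of \<open>e\<^sub>0\<close>.
\<close>

definition is_flip :: "'e rotation \<Rightarrow> 'e rotation \<Rightarrow> 'e \<Rightarrow> 'e \<Rightarrow> 'e \<Rightarrow> 'e \<Rightarrow> 'e \<Rightarrow> bool" where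
  "is_flip \<sigma> \<sigma>' e\<^sub>0 e\<^sub>1 e\<^sub>2 e\<^sub>3 e\<^sub>4 \<longleftrightarrow>
     distinct [e\<^sub>0, e\<^sub>1, e\<^sub>2, e\<^sub>3, e\<^sub>4] \<and>
     (\<exists>l r t b d\<^sub>1 d\<^sub>2 d\<^sub>3 d\<^sub>4.
        fst l = e\<^sub>0 \<and> r = opp l \<and> fst t = e\<^sub>0 \<and> b = opp t \<and>
        fst d\<^sub>1 = e\<^sub>1 \<and> fst d\<^sub>2 = e\<^sub>2 \<and> fst d\<^sub>3 = e\<^sub>3 \<and> fst d\<^sub>4 = e\<^sub>4 \<and>
        \<sigma> l = d\<^sub>1 \<and> \<sigma> d\<^sub>1 = d\<^sub>2 \<and> \<sigma> d\<^sub>2 = l \<and>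
        \<sigma> r = d\<^sub>3 \<and> \<sigma> d\<^sub>3 = d\<^sub>4 \<and> \<sigma> d\<^sub>4 = r \<and>
        \<sigma>' t = d\<^sub>4 \<and> \<sigma>' d\<^sub>4 = d\<^sub>1 \<and> \<sigma>' d\<^sub>1 = t \<and>
        \<sigma>' b = d\<^sub>2 \<and> \<sigma>' d\<^sub>2 = d\<^sub>3 \<and> \<sigma>' d\<^sub>3 = b \<and>
        (\<forall>d. d \<notin> {l, r, d\<^sub>1, d\<^sub>2, d\<^sub>3, d\<^sub>4} \<longrightarrow> \<sigma>' d = \<sigma> d))"

section \<open>The quantum torus\<close>

text \<open>
  The type \<open>int \<Rightarrow>\<^sub>0 complex\<close> with its convolution product is the ring of Laurent polynomials in \<open>q\<close>.
\<close>

type_synonym laurent = "int \<Rightarrow>\<^sub>0 complex"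

definition qpow :: "int \<Rightarrow> laurent" where
  "qpow k = Poly_Mapping.single k 1"

type_synonym 'e lattice = "'e \<Rightarrow>\<^sub>0 int"

definition edge_vec :: "'e \<Rightarrow> 'e lattice" where
  "edge_vec e = Poly_Mapping.single e 1"

definition edge_sum :: "'e list \<Rightarrow> 'e lattice" where
  "edge_sum es = sum_list (map edge_vec es)"

text \<open>
  A dart \<open>d\<close> of \<open>e\<close> with \<open>\<sigma> d\<close> a dart of \<open>e'\<close> is an occurrence of \<open>e\<close> immediately preceding \<open>e'\<close>
  at a vertex.
\<close>

definition edge_form :: "('e::finite) rotation \<Rightarrow> 'e \<Rightarrow> 'e \<Rightarrow> int" where
  "edge_form \<sigma> e e' =
     int (card {d. fst d = e \<and> fst (\<sigma> d) = e'}) - int (card {d. fst d = e' \<and> fst (\<sigma> d) = e})"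

definition form :: "('e::finite) rotation \<Rightarrow> 'e lattice \<Rightarrow> 'e lattice \<Rightarrow> int" where
  "form \<sigma> v w =
     (\<Sum>e\<in>UNIV. \<Sum>e'\<in>UNIV. Poly_Mapping.lookup v e * Poly_Mapping.lookup w e' * edge_form \<sigma> e e')"

text \<open>
  An element \<open>\<Sum>v. c\<^sub>v X\<^sub>v\<close> is the finitely supported function \<open>v \<mapsto> c\<^sub>v\<close>. Addition and subtraction
  are those of the type \<open>'e torus\<close>, but the type's own product is the untwisted one: products in
  the quantum torus are taken in the ring \<open>quantum_torus \<sigma>\<close> only.
\<close>

type_synonym 'e torus = "'e lattice \<Rightarrow>\<^sub>0 laurent"

definition torus_mult :: "('e::finite) rotation \<Rightarrow> 'e torus \<Rightarrow> 'e torus \<Rightarrow> 'e torus" where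
  "torus_mult \<sigma> a b =
     (\<Sum>v\<in>Poly_Mapping.keys a. \<Sum>w\<in>Poly_Mapping.keys b.
        Poly_Mapping.single (v + w)
          (Poly_Mapping.lookup a v * Poly_Mapping.lookup b w * qpow (form \<sigma> v w)))"

text \<open>\<open>monomial c v\<close> is \<open>c X\<^sub>v\<close>, so that \<open>c \<mapsto> monomial c 0\<close> is the structure map of the algebra.\<close>

definition monomial :: "laurent \<Rightarrow> 'e lattice \<Rightarrow> 'e torus" where
  "monomial c v = Poly_Mapping.single v c"

abbreviation X :: "'e lattice \<Rightarrow> 'e torus" where
  "X v \<equiv> monomial 1 v"

abbreviation scalar :: "laurent \<Rightarrow> 'e torus" where
  "scalar c \<equiv> monomial c 0"

definition quantum_torus :: "('e::finite) rotation \<Rightarrow> 'e torus ring" where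
  "quantum_torus \<sigma> =
     \<lparr>carrier = UNIV, monoid.mult = torus_mult \<sigma>, one = X 0, zero = 0, add = (+)\<rparr>"

lemma monomial_mult_monomial:
  "monomial c v \<otimes>\<^bsub>quantum_torus \<sigma>\<^esub> monomial d w = monomial (c * d * qpow (form \<sigma> v w)) (v + w)"
  by (cases "c = 0"; cases "d = 0")
     (simp_all add: quantum_torus_def torus_mult_def monomial_def)

lemma X_mult_X:
  "X v \<otimes>\<^bsub>quantum_torus \<sigma>\<^esub> X w = scalar (qpow (form \<sigma> v w)) \<otimes>\<^bsub>quantum_torus \<sigma>\<^esub> X (v + w)"
proof -
  have "form \<sigma> 0 (v + w) = 0" and "qpow 0 = 1"
    by (simp_all add: form_def qpow_def)
  then show ?thesis
    by (simp add: monomial_mult_monomial)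
qed

section \<open>The chromatic ideal\<close>

definition left_ideal :: "('a, 'm) ring_scheme \<Rightarrow> 'a set \<Rightarrow> bool" where
  "left_ideal R I \<longleftrightarrow>
     additive_subgroup I R \<and> (\<forall>x\<in>carrier R. \<forall>a\<in>I. x \<otimes>\<^bsub>R\<^esub> a \<in> I)"

definition left_genideal :: "('a, 'm) ring_scheme \<Rightarrow> 'a set \<Rightarrow> 'a set" where
  "left_genideal R A = \<Inter> {I. left_ideal R I \<and> A \<subseteq> I}"

text \<open>The three families of generators. In the first and the third one, \<open>d\<close> runs over all darts, that
  is, over all faces together with all choices of the edge called \<open>e\<^sub>1\<close>.\<close>

definition face_relation :: "('e::finite) rotation \<Rightarrow> 'e dart \<Rightarrow> 'e torus" where
  "face_relation \<sigma> d = X (edge_sum (face_edges \<sigma> d)) - scalar (qpow (- 2))"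

definition total_relation :: "nat \<Rightarrow> ('e::finite) torus" where
  "total_relation g =
     X (\<Sum>e\<in>UNIV. edge_vec e) - scalar ((- 1) ^ (g + 3) * qpow (- int (g + 3)))"

definition R_face :: "('e::finite) rotation \<Rightarrow> 'e dart \<Rightarrow> 'e torus" where
  "R_face \<sigma> d =
     scalar (qpow (- 1)) +
     (\<Sum>k\<in>{1..<length (face_edges \<sigma> d)}. X (edge_sum (take k (face_edges \<sigma> d))))"

definition chromatic_ideal :: "nat \<Rightarrow> ('e::finite) rotation \<Rightarrow> 'e torus set" where
  "chromatic_ideal g \<sigma> =
     left_genideal (quantum_torus \<sigma>)
       (range (face_relation \<sigma>) \<union> {total_relation g} \<union> range (R_face \<sigma>))"

section \<open>Localization and quantum mutation\<close>

text \<open>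
  \<open>L\<close> together with \<open>\<iota> : R \<rightarrow> L\<close> is a localization (ring of left fractions) of \<open>R\<close> at the
  multiplicative set \<open>S\<close>. This determines the pair up to unique isomorphism.
\<close>

definition is_localization ::
    "('a, 'm) ring_scheme \<Rightarrow> 'a set \<Rightarrow> ('l, 'n) ring_scheme \<Rightarrow> ('a \<Rightarrow> 'l) \<Rightarrow> bool" where
  "is_localization R S L \<iota> \<longleftrightarrow>
     ring L \<and> \<iota> \<in> ring_hom R L \<and>
     (\<forall>s\<in>S. \<iota> s \<in> Units L) \<and>
     (\<forall>x\<in>carrier L. \<exists>s\<in>S. \<exists>a\<in>carrier R. x = inv\<^bsub>L\<^esub> (\<iota> s) \<otimes>\<^bsub>L\<^esub> \<iota> a) \<and>
     (\<forall>a\<in>carrier R. \<iota> a = \<zero>\<^bsub>L\<^esub> \<longleftrightarrow> (\<exists>s\<in>S. s \<otimes>\<^bsub>R\<^esub> a = \<zero>\<^bsub>R\<^esub>))"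

text \<open>The finite products of elements \<open>1 + q\<^bsup>2k+1\<^esup> X\<^sub>e\<close> with integers \<open>k\<close>; these elements commute.\<close>

definition ore_set :: "('e::finite) rotation \<Rightarrow> 'e \<Rightarrow> 'e torus set" where
  "ore_set \<sigma> e =
     range (\<lambda>ks. foldr (\<lambda>k s. (X 0 + monomial (qpow (2 * k + 1)) (edge_vec e)) \<otimes>\<^bsub>quantum_torus \<sigma>\<^esub> s)
       ks \<one>\<^bsub>quantum_torus \<sigma>\<^esub>)"

text \<open>
  \<open>(L, \<iota>)\<close> stands for the localization of the torus of \<open>\<Gamma>\<close> and \<open>(L', \<iota>')\<close> for that of \<open>\<Gamma>'\<close>. As
  the \<open>X'\<^sub>e\<close>, their inverses, the scalars and the inverted elements generate \<open>L'\<close>, there is only one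
  such \<open>\<mu>\<close> (on the carrier of \<open>L'\<close>).
\<close>

definition is_quantum_mutation ::
    "('l, 'm) ring_scheme \<Rightarrow> (('e::finite) torus \<Rightarrow> 'l) \<Rightarrow> ('k, 'n) ring_scheme \<Rightarrow> ('e torus \<Rightarrow> 'k) \<Rightarrow>
     'e \<Rightarrow> 'e \<Rightarrow> 'e \<Rightarrow> 'e \<Rightarrow> 'e \<Rightarrow> ('k \<Rightarrow> 'l) \<Rightarrow> bool" where
  "is_quantum_mutation L \<iota> L' \<iota>' e\<^sub>0 e\<^sub>1 e\<^sub>2 e\<^sub>3 e\<^sub>4 \<mu> \<longleftrightarrow>
     (let x = (\<lambda>e. \<iota> (X (edge_vec e)));
          x' = (\<lambda>e. \<iota>' (X (edge_vec e)));
          u = \<iota> (X 0 + monomial (qpow 1) (edge_vec e\<^sub>0));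
          w = \<iota> (X 0 + monomial (qpow 1) (- edge_vec e\<^sub>0))
      in \<mu> \<in> ring_iso L' L \<and>
         (\<forall>c. \<mu> (\<iota>' (scalar c)) = \<iota> (scalar c)) \<and>
         \<mu> (x' e\<^sub>0) = \<iota> (X (- edge_vec e\<^sub>0)) \<and>
         \<mu> (x' e\<^sub>1) = x e\<^sub>1 \<otimes>\<^bsub>L\<^esub> u \<and>
         \<mu> (x' e\<^sub>2) = x e\<^sub>2 \<otimes>\<^bsub>L\<^esub> inv\<^bsub>L\<^esub> w \<and>
         \<mu> (x' e\<^sub>3) = x e\<^sub>3 \<otimes>\<^bsub>L\<^esub> u \<and>
         \<mu> (x' e\<^sub>4) = x e\<^sub>4 \<otimes>\<^bsub>L\<^esub> inv\<^bsub>L\<^esub> w \<and>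
         (\<forall>e. e \<notin> {e\<^sub>0, e\<^sub>1, e\<^sub>2, e\<^sub>3, e\<^sub>4} \<longrightarrow> \<mu> (x' e) = x e))"

definition localized_chromatic_ideal ::
    "nat \<Rightarrow> ('e::finite) rotation \<Rightarrow> ('l, 'm) ring_scheme \<Rightarrow> ('e torus \<Rightarrow> 'l) \<Rightarrow> 'l set" where
  "localized_chromatic_ideal g \<sigma> L \<iota> = left_genideal L (\<iota> ` chromatic_ideal g \<sigma>)"

end

theory Submission
  imports Defs
begin

text \<open>
  The mutation matches the generators of the two ideals one by one, up to left multiplication by
  units. It sends \<open>X'\<^sub>v\<close> to \<open>X\<close> at the image of \<open>v\<close> under an isometry \<open>\<Lambda>\<^bsub>\<Gamma>'\<^esub> \<rightarrow> \<Lambda>\<^bsub>\<Gamma>\<^esub>\<close>, times a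
  factor depending only on the pairing of \<open>v\<close> with \<open>e\<^sub>0\<close>. For the sum of the edges of a face and for
  the sum of all edges this pairing vanishes, so the relations of types (1) and (2) correspond
  exactly. For a face that loses \<open>e\<^sub>0\<close> in the flip, take the edge after \<open>e\<^sub>0\<close> as the first one in
  \<open>\<Gamma>'\<close> and \<open>e\<^sub>0\<close> itself in \<open>\<Gamma>\<close>: all proper partial sums then have the same pairing with \<open>e\<^sub>0\<close>, and
  \<open>(1 + q X\<^bsub>e\<^sub>0\<^esub>) \<mu>\<^sub>0(R'\<^sub>f) = R\<^sub>f\<close>. Similarly \<open>\<mu>\<^sub>0(R'\<^sub>f) = (1 + q X\<^bsub>-e\<^sub>0\<^esub>) R\<^sub>f\<close> if the face gains
  \<open>e\<^sub>0\<close>, and \<open>\<mu>\<^sub>0(R'\<^sub>f) = R\<^sub>f\<close> for the remaining faces. The first edge may be chosen freely since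
  moving it on from \<open>e\<^sub>1\<close> to \<open>e\<^sub>2\<close> changes \<open>R\<^sub>f\<close> by the identity
  \<open>q X\<^bsub>e\<^sub>1\<^esub> R\<^sub>f\<^bsup>(e\<^sub>2)\<^esup> = R\<^sub>f\<^bsup>(e\<^sub>1)\<^esup> + q (X\<^bsub>e\<^sub>1+\<dots>+e\<^sub>n\<^esub> - q\<^bsup>-2\<^esup>)\<close>.
\<close>

section \<open>Left ideals\<close>

lemma left_idealD:
  assumes "ring R" "left_ideal R J"
  shows left_ideal_subset: "J \<subseteq> carrier R"
    and left_ideal_add: "\<And>a b. a \<in> J \<Longrightarrow> b \<in> J \<Longrightarrow> a \<oplus>\<^bsub>R\<^esub> b \<in> J"
    and left_ideal_uminus: "\<And>a. a \<in> J \<Longrightarrow> \<ominus>\<^bsub>R\<^esub> a \<in> J"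
    and left_ideal_mult: "\<And>x a. x \<in> carrier R \<Longrightarrow> a \<in> J \<Longrightarrow> x \<otimes>\<^bsub>R\<^esub> a \<in> J"
proof -
  interpret ring R by fact
  interpret additive_subgroup J R using assms(2) by (simp add: left_ideal_def)
  show "J \<subseteq> carrier R" by (rule a_subset)
  show "a \<oplus>\<^bsub>R\<^esub> b \<in> J" if "a \<in> J" "b \<in> J" for a b using that by simp
  show "\<ominus>\<^bsub>R\<^esub> a \<in> J" if "a \<in> J" for a using that by simp
  show "x \<otimes>\<^bsub>R\<^esub> a \<in> J" if "x \<in> carrier R" "a \<in> J" for x a
    using that assms(2) by (simp add: left_ideal_def)
qed

lemma left_ideal_add_cancel:
  assumes "ring R" "left_ideal R J" "a \<in> carrier R" "b \<in> J" "a \<oplus>\<^bsub>R\<^esub> b \<in> J"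
  shows "a \<in> J"
proof -
  interpret ring R by fact
  have b: "b \<in> carrier R" using left_ideal_subset[OF assms(1,2)] assms(4) by blast
  have "(a \<oplus>\<^bsub>R\<^esub> b) \<oplus>\<^bsub>R\<^esub> \<ominus>\<^bsub>R\<^esub> b \<in> J"
    using assms(4,5) by (metis left_ideal_add[OF assms(1,2)] left_ideal_uminus[OF assms(1,2)])
  also have "(a \<oplus>\<^bsub>R\<^esub> b) \<oplus>\<^bsub>R\<^esub> \<ominus>\<^bsub>R\<^esub> b = a"
    using assms(3) b by (simp add: a_assoc r_neg)
  finally show ?thesis .
qed

text \<open>Generators that agree up to a unit factor on the left therefore lie in the same left
  ideals.\<close>

lemma left_ideal_unit_mult_iff:
  assumes "ring R" "left_ideal R J" "u \<in> Units R" "a \<in> carrier R"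
  shows "u \<otimes>\<^bsub>R\<^esub> a \<in> J \<longleftrightarrow> a \<in> J"
proof
  interpret ring R by fact
  show "u \<otimes>\<^bsub>R\<^esub> a \<in> J" if "a \<in> J"
    using that assms by (intro left_ideal_mult) auto
  show "a \<in> J" if "u \<otimes>\<^bsub>R\<^esub> a \<in> J"
  proof -
    have "inv\<^bsub>R\<^esub> u \<otimes>\<^bsub>R\<^esub> (u \<otimes>\<^bsub>R\<^esub> a) \<in> J"
      by (rule left_ideal_mult[OF assms(1,2) _ that]) (simp add: assms(3))
    moreover have "inv\<^bsub>R\<^esub> u \<otimes>\<^bsub>R\<^esub> (u \<otimes>\<^bsub>R\<^esub> a) = a"
      using assms(3,4) by (simp add: m_assoc[symmetric] Units_closed)
    ultimately show ?thesis by simp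
  qed
qed

lemma ring_hom_abelian_group_hom:
  assumes "abelian_group R" "abelian_group S" "h \<in> ring_hom R S"
  shows "abelian_group_hom R S h"
proof (rule abelian_group_homI[OF assms(1,2)])
  show "group_hom (add_monoid R) (add_monoid S) h"
    using assms abelian_group.a_group[OF assms(1)] abelian_group.a_group[OF assms(2)]
    by (auto simp: group_hom_def group_hom_axioms_def hom_def ring_hom_def)
qed

text \<open>The source \<open>R\<close> enters as an abelian group closed under multiplication, so
  that the lemma applies to the quantum torus as soon as its additive group is known.\<close>

lemma left_ideal_vimage:
  assumes "abelian_group R" "ring S" "h \<in> ring_hom R S" "left_ideal S J"
    and "\<And>x y. x \<in> carrier R \<Longrightarrow> y \<in> carrier R \<Longrightarrow> x \<otimes>\<^bsub>R\<^esub> y \<in> carrier R"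
  shows "left_ideal R {a \<in> carrier R. h a \<in> J}"
proof -
  interpret S: ring S by fact
  interpret J: additive_subgroup J S using assms(4) by (simp add: left_ideal_def)
  interpret h: abelian_group_hom R S h
    by (rule ring_hom_abelian_group_hom[OF assms(1) S.abelian_group_axioms assms(3)])
  have "subgroup {a \<in> carrier R. h a \<in> J} (add_monoid R)"
  proof (rule group.subgroupI)
    show "group (add_monoid R)" by (rule h.G.a_group)
    show "{a \<in> carrier R. h a \<in> J} \<noteq> {}"
      using h.hom_zero J.zero_closed h.G.zero_closed by (auto intro!: exI[of _ "\<zero>\<^bsub>R\<^esub>"])
  qed (auto simp: a_inv_def[symmetric])
  moreover have "x \<otimes>\<^bsub>R\<^esub> a \<in> {a \<in> carrier R. h a \<in> J}"
    if "x \<in> carrier R" "a \<in> {a \<in> carrier R. h a \<in> J}" for x a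
    using that assms(3,5) ring_hom_memE[OF assms(3)] left_ideal_mult[OF assms(2,4)]
    by auto
  ultimately show ?thesis
    by (simp add: left_ideal_def additive_subgroup.intro)
qed

lemma left_genideal_minimal: "left_ideal R J \<Longrightarrow> A \<subseteq> J \<Longrightarrow> left_genideal R A \<subseteq> J"
  by (auto simp: left_genideal_def)

lemma left_genideal_superset: "A \<subseteq> left_genideal R A"
  by (auto simp: left_genideal_def)

text \<open>The preimage of a left ideal containing the image of \<open>A\<close> is a left ideal
  containing \<open>A\<close>.\<close>

lemma image_left_genideal_subset:
  assumes "abelian_group R" "ring S" "h \<in> ring_hom R S" "A \<subseteq> carrier R"
    and "\<And>x y. x \<in> carrier R \<Longrightarrow> y \<in> carrier R \<Longrightarrow> x \<otimes>\<^bsub>R\<^esub> y \<in> carrier R"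
  shows "h ` left_genideal R A \<subseteq> left_genideal S (h ` A)"
proof (clarsimp simp: left_genideal_def[of S])
  fix a J assume a: "a \<in> left_genideal R A" and J: "left_ideal S J" "h ` A \<subseteq> J"
  have "left_genideal R A \<subseteq> {a \<in> carrier R. h a \<in> J}"
    using J assms by (intro left_genideal_minimal left_ideal_vimage) auto
  then show "h a \<in> J" using a by auto
qed

text \<open>Extension of ideals along \<open>h\<close> may be computed on generators; this reduces
  the localized chromatic ideals to the three families of relations.\<close>

lemma left_genideal_image_left_genideal:
  assumes "abelian_group R" "ring S" "h \<in> ring_hom R S" "A \<subseteq> carrier R"
    and "\<And>x y. x \<in> carrier R \<Longrightarrow> y \<in> carrier R \<Longrightarrow> x \<otimes>\<^bsub>R\<^esub> y \<in> carrier R"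
  shows "left_genideal S (h ` left_genideal R A) = left_genideal S (h ` A)"
proof -
  have "h ` left_genideal R A \<subseteq> J \<longleftrightarrow> h ` A \<subseteq> J" if "left_ideal S J" for J
    using image_left_genideal_subset[OF assms] left_genideal_minimal[OF that, of "h ` A"]
      left_genideal_superset[of A R] by blast
  then show ?thesis unfolding left_genideal_def[of S] by (intro arg_cong[where f = Inter]) blast
qed

lemma ring_iso_image_left_genideal:
  assumes "ring R" "ring S" "h \<in> ring_iso R S" "A \<subseteq> carrier R"
  shows "h ` left_genideal R A = left_genideal S (h ` A)"
proof
  interpret R: ring R by fact
  interpret S: ring S by fact
  have h: "h \<in> ring_hom R S" "bij_betw h (carrier R) (carrier S)"
    using assms(3) by (auto simp: ring_iso_def)
  show "h ` left_genideal R A \<subseteq> left_genideal S (h ` A)"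
    by (rule image_left_genideal_subset[OF R.abelian_group_axioms assms(2) h(1) assms(4)]) simp
  let ?k = "inv_into (carrier R) h"
  have hA: "h ` A \<subseteq> carrier S" using assms(4) h(2) by (auto simp: bij_betw_def)
  have k: "?k \<in> ring_hom S R"
    using ring_iso_set_sym[OF assms(1,3)] by (simp add: ring_iso_def)
  have "?k ` left_genideal S (h ` A) \<subseteq> left_genideal R (?k ` h ` A)"
    by (rule image_left_genideal_subset[OF S.abelian_group_axioms assms(1) k hA]) simp
  also have "?k ` h ` A = A"
    using h(2) assms(4) by (simp add: bij_betw_def inv_into_image_cancel)
  finally have *: "?k ` left_genideal S (h ` A) \<subseteq> left_genideal R A" .
  have "left_ideal S (carrier S)"
    by (simp add: left_ideal_def additive_subgroup_def S.add.subgroup_self)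
  then have "left_genideal S (h ` A) \<subseteq> carrier S"
    using hA by (rule left_genideal_minimal)
  then have "x \<in> h ` left_genideal R A" if "x \<in> left_genideal S (h ` A)" for x
    using * that h(2) f_inv_into_f[of x h "carrier R"]
    by (metis bij_betw_imp_surj_on image_subset_iff rev_image_eqI subsetD)
  then show "left_genideal S (h ` A) \<subseteq> h ` left_genideal R A" by blast
qed

section \<open>Arithmetic of the quantum torus\<close>

lemma form_0_left [simp]: "form \<sigma> 0 w = 0" and form_0_right [simp]: "form \<sigma> v 0 = 0"
  by (simp_all add: form_def)

lemma form_minus_left: "form \<sigma> (- v) w = - form \<sigma> v w"
  and form_minus_right: "form \<sigma> v (- w) = - form \<sigma> v w"
  by (simp_all add: form_def sum_negf)

text \<open>Each dart contributes one local term, so the forms of two rotations can be compared term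
  by term wherever the rotations agree.\<close>

lemma form_eq_sum_darts:
  "form \<sigma> v w = (\<Sum>d\<in>UNIV. Poly_Mapping.lookup v (fst d) * Poly_Mapping.lookup w (fst (\<sigma> d)) - Poly_Mapping.lookup w (fst d) * Poly_Mapping.lookup v (fst (\<sigma> d)))"
proof -
  have card: "int (card {d. P d}) = (\<Sum>d\<in>UNIV. if P d then 1 else 0)" for P :: "'a dart \<Rightarrow> bool"
    by (simp add: sum.If_cases)
  have "form \<sigma> v w = (\<Sum>e\<in>UNIV. \<Sum>e'\<in>UNIV. \<Sum>d\<in>UNIV.
     (if fst d = e then Poly_Mapping.lookup v e * (if fst (\<sigma> d) = e' then Poly_Mapping.lookup w e' else 0) else 0)
     - (if fst (\<sigma> d) = e then Poly_Mapping.lookup v e * (if fst d = e' then Poly_Mapping.lookup w e' else 0) else 0))"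
    unfolding form_def edge_form_def card sum_subtractf[symmetric] sum_distrib_left
    by (intro sum.cong refl) auto
  also have "\<dots> = (\<Sum>d\<in>UNIV. \<Sum>e\<in>UNIV. \<Sum>e'\<in>UNIV.
     (if fst d = e then Poly_Mapping.lookup v e * (if fst (\<sigma> d) = e' then Poly_Mapping.lookup w e' else 0) else 0)
     - (if fst (\<sigma> d) = e then Poly_Mapping.lookup v e * (if fst d = e' then Poly_Mapping.lookup w e' else 0) else 0))"
    by (subst sum.swap[of _ UNIV "UNIV :: 'a dart set"]) (intro sum.cong refl sum.swap)
  also have "\<dots> = (\<Sum>d\<in>UNIV. Poly_Mapping.lookup v (fst d) * Poly_Mapping.lookup w (fst (\<sigma> d)) - Poly_Mapping.lookup w (fst d) * Poly_Mapping.lookup v (fst (\<sigma> d)))"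
  proof (intro sum.cong refl)
    fix d
    have *: "(\<Sum>e'\<in>UNIV. if P then a * (if x = e' then f e' else 0) else (0::int)) = (if P then a * f x else 0)"
      for P a f and x :: 'a
      by (simp add: sum_distrib_left[symmetric])
    show "(\<Sum>e\<in>UNIV. \<Sum>e'\<in>UNIV.
     (if fst d = e then Poly_Mapping.lookup v e * (if fst (\<sigma> d) = e' then Poly_Mapping.lookup w e' else 0) else 0)
     - (if fst (\<sigma> d) = e then Poly_Mapping.lookup v e * (if fst d = e' then Poly_Mapping.lookup w e' else 0) else 0)) = Poly_Mapping.lookup v (fst d) * Poly_Mapping.lookup w (fst (\<sigma> d)) - Poly_Mapping.lookup w (fst d) * Poly_Mapping.lookup v (fst (\<sigma> d))"
      by (simp add: sum_subtractf * mult.commute)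
  qed
  finally show ?thesis .
qed

lemma form_skew: "form \<sigma> w v = - form \<sigma> v w"
  unfolding form_eq_sum_darts sum_negf[symmetric] by (intro sum.cong refl) simp

lemma form_self [simp]: "form \<sigma> v v = 0"
  by (simp add: form_eq_sum_darts)

lemma qpow_add: "qpow (a + b) = qpow a * qpow b" and qpow_0 [simp]: "qpow 0 = 1"
  by (simp_all add: qpow_def mult_single)

lemma qpow_simps:
  "qpow a * qpow b = qpow (a + b)" "qpow a * (qpow b * c) = qpow (a + b) * c"
  by (simp_all add: qpow_add mult.assoc)

text \<open>Supports may shrink when elements are added, so additivity is read off after the sums
  are extended to common finite sets containing all keys.\<close>

lemma torus_mult_cong_sets:
  assumes "finite A" "finite B" "Poly_Mapping.keys a \<subseteq> A" "Poly_Mapping.keys b \<subseteq> B"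
  shows "torus_mult \<sigma> a b = (\<Sum>v\<in>A. \<Sum>w\<in>B.
    Poly_Mapping.single (v + w) (Poly_Mapping.lookup a v * Poly_Mapping.lookup b w * qpow (form \<sigma> v w)))"
proof -
  have "torus_mult \<sigma> a b = (\<Sum>v\<in>Poly_Mapping.keys a. \<Sum>w\<in>B.
    Poly_Mapping.single (v + w) (Poly_Mapping.lookup a v * Poly_Mapping.lookup b w * qpow (form \<sigma> v w)))"
    unfolding torus_mult_def using assms
    by (intro sum.cong refl sum.mono_neutral_left) (auto simp: in_keys_iff)
  also have "\<dots> = (\<Sum>v\<in>A. \<Sum>w\<in>B.
    Poly_Mapping.single (v + w) (Poly_Mapping.lookup a v * Poly_Mapping.lookup b w * qpow (form \<sigma> v w)))"
    using assms by (intro sum.mono_neutral_left) (auto simp: in_keys_iff)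
  finally show ?thesis .
qed

lemma torus_mult_add_left: "torus_mult \<sigma> (a + a') b = torus_mult \<sigma> a b + torus_mult \<sigma> a' b"
proof -
  let ?A = "Poly_Mapping.keys a \<union> Poly_Mapping.keys a'" and ?B = "Poly_Mapping.keys b"
  have "Poly_Mapping.keys (a + a') \<subseteq> ?A" by (rule keys_add)
  then show ?thesis
    by (subst (1 2 3) torus_mult_cong_sets[of ?A ?B])
      (auto simp: lookup_add distrib_right single_add sum.distrib)
qed

lemma torus_mult_add_right: "torus_mult \<sigma> a (b + b') = torus_mult \<sigma> a b + torus_mult \<sigma> a b'"
proof -
  let ?B = "Poly_Mapping.keys b \<union> Poly_Mapping.keys b'" and ?A = "Poly_Mapping.keys a"
  have "Poly_Mapping.keys (b + b') \<subseteq> ?B" by (rule keys_add)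
  then show ?thesis
    by (subst (1 2 3) torus_mult_cong_sets[of ?A ?B])
      (auto simp: lookup_add distrib_left distrib_right single_add sum.distrib)
qed

lemma torus_mult_0 [simp]: "torus_mult \<sigma> 0 b = 0" "torus_mult \<sigma> a 0 = 0"
  by (simp_all add: torus_mult_def)

lemma torus_mult_uminus_right: "torus_mult \<sigma> a (- b) = - torus_mult \<sigma> a b"
  using torus_mult_add_right[of \<sigma> a b "- b"] by (simp add: add_eq_0_iff)

lemma torus_mult_diff_right: "torus_mult \<sigma> a (b - b') = torus_mult \<sigma> a b - torus_mult \<sigma> a b'"
  using torus_mult_add_right[of \<sigma> a b "- b'"] by (simp add: torus_mult_uminus_right)

lemma torus_mult_sum_left: "torus_mult \<sigma> (sum f K) b = (\<Sum>k\<in>K. torus_mult \<sigma> (f k) b)"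
  by (induction K rule: infinite_finite_induct) (simp_all add: torus_mult_add_left)

lemma torus_mult_sum_right: "torus_mult \<sigma> a (sum f K) = (\<Sum>k\<in>K. torus_mult \<sigma> a (f k))"
  by (induction K rule: infinite_finite_induct) (simp_all add: torus_mult_add_right)

lemma torus_mult_monomial:
  "torus_mult \<sigma> (monomial c v) (monomial d w) = monomial (c * d * qpow (form \<sigma> v w)) (v + w)"
  using monomial_mult_monomial[where \<sigma> = \<sigma> and c = c and v = v and d = d and w = w]
  by (simp add: quantum_torus_def)

lemma quantum_torus_sel [simp]:
  "carrier (quantum_torus \<sigma>) = UNIV" "monoid.mult (quantum_torus \<sigma>) = torus_mult \<sigma>"
  "one (quantum_torus \<sigma>) = X 0" "zero (quantum_torus \<sigma>) = 0" "add (quantum_torus \<sigma>) = (+)"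
  by (simp_all add: quantum_torus_def)

lemma abelian_group_quantum_torus: "abelian_group (quantum_torus \<sigma>)"
  by (rule abelian_groupI) (auto simp: add_ac intro: exI[of _ "- x" for x] add.left_inverse)

lemma left_genideal_image_chromatic_ideal:
  assumes "ring S" "h \<in> ring_hom (quantum_torus \<sigma>) S"
  shows "left_genideal S (h ` chromatic_ideal g \<sigma>) =
    left_genideal S (h ` (range (face_relation \<sigma>) \<union> {total_relation g} \<union> range (R_face \<sigma>)))"
  unfolding chromatic_ideal_def
  by (rule left_genideal_image_left_genideal[OF abelian_group_quantum_torus assms]) simp_all

section \<open>Faces as cyclic lists of darts\<close>

text \<open>One full period of \<open>f\<close>, listed once in order. Faces become lists, and a
  flip deletes or inserts one entry.\<close>

definition cyclic_list :: "('a \<Rightarrow> 'a) \<Rightarrow> 'a list \<Rightarrow> bool" where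
  "cyclic_list f xs \<longleftrightarrow> xs \<noteq> [] \<and> distinct xs \<and> map f xs = rotate1 xs"

lemma cyclic_list_nth:
  assumes "cyclic_list f (x # xs)" "i \<le> length xs"
  shows "f ((x # xs) ! i) = (xs @ [x]) ! i"
proof -
  have "f ((x # xs) ! i) = map f (x # xs) ! i"
    using assms(2) by (intro nth_map[symmetric]) simp
  also have "map f (x # xs) = xs @ [x]"
    using assms(1) by (simp add: cyclic_list_def)
  finally show ?thesis .
qed

lemma cyclic_list_funpow:
  assumes "cyclic_list f (x # xs)" "i \<le> length xs"
  shows "(f ^^ i) x = (x # xs) ! i"
  using assms(2)
proof (induction i)
  case (Suc i)
  then show ?case using cyclic_list_nth[OF assms(1), of i] by (simp add: nth_append)
qed simp

lemma cyclic_list_funpow_length: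
  assumes "cyclic_list f (x # xs)"
  shows "(f ^^ Suc (length xs)) x = x"
  using cyclic_list_nth[OF assms, of "length xs"] cyclic_list_funpow[OF assms, of "length xs"]
  by simp

lemma orbit_cyclic_list:
  assumes "cyclic_list f (x # xs)"
  shows "orbit f x = set (x # xs)"
proof -
  have "orbit f x = {(f ^^ m) x | m. m < Suc (length xs)}"
    by (rule orbit_altdef_bounded[OF cyclic_list_funpow_length[OF assms]]) simp
  also have "\<dots> = {(x # xs) ! m | m. m < length (x # xs)}"
    using cyclic_list_funpow[OF assms] by (metis (no_types, lifting) length_Cons less_Suc_eq_le)
  finally show ?thesis by (simp add: set_conv_nth)
qed

lemma cyclic_list_step_iff:
  assumes "cyclic_list f xs" "inj f"
  shows "f x \<in> set xs \<longleftrightarrow> x \<in> set xs"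
proof -
  have "f ` set xs = set xs" using assms(1) by (metis cyclic_list_def set_map set_rotate1)
  then show ?thesis using assms(2) by (metis inj_image_mem_iff)
qed

lemma cyclic_list_rotate1:
  "cyclic_list f xs \<Longrightarrow> cyclic_list f (rotate1 xs)"
  by (auto simp: cyclic_list_def rotate1_map[symmetric])

lemma ex_cyclic_list:
  assumes "permutation f"
  shows "\<exists>xs. cyclic_list f (x # xs)"
proof -
  \<comment> \<open>\<open>?n\<close> is one less than the period of \<open>x\<close>, hence the
    upper bound \<open>Suc ?n\<close> throughout.\<close>
  let ?n = "funpow_dist f (f x) x" and ?g = "\<lambda>i. (f ^^ i) x"
  have x: "x \<in> orbit f x" by (rule permutation_self_in_orbit[OF assms])
  have "map f (map ?g [0..<Suc ?n]) = map ?g (map Suc [0..<Suc ?n])"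
    by (simp add: comp_def)
  also have "\<dots> = map ?g [1..<Suc ?n] @ [?g (Suc ?n)]"
    by (simp add: map_Suc_upt del: upt_Suc) simp
  also have "?g (Suc ?n) = x" by (rule funpow_dist1_prop[OF x])
  also have "map ?g [1..<Suc ?n] @ [x] = rotate1 (map ?g [0..<Suc ?n])"
    by (simp add: upt_conv_Cons del: upt_Suc)
  finally have "cyclic_list f (map ?g [0..<Suc ?n])"
    using inj_on_funpow_dist1[OF x] unfolding cyclic_list_def distinct_map by (simp del: upt_Suc)
  moreover have "map ?g [0..<Suc ?n] = x # map ?g [1..<Suc ?n]"
    by (simp add: upt_conv_Cons del: upt_Suc)
  ultimately show ?thesis by metis
qed

lemma face_edges_cyclic_list:
  assumes "cyclic_list (face_step \<sigma>) (d # ds)"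
  shows "face_edges \<sigma> d = map fst (d # ds)"
proof -
  have "card (orbit (face_step \<sigma>) d) = length (d # ds)"
    using assms orbit_cyclic_list[OF assms] by (metis cyclic_list_def distinct_card)
  moreover have "map (\<lambda>i. (face_step \<sigma> ^^ i) d) [0..<length (d # ds)] = d # ds"
    by (rule nth_equalityI) (use cyclic_list_funpow[OF assms] in \<open>auto simp del: upt_Suc simp: less_Suc_eq_le\<close>)
  ultimately show ?thesis
    unfolding face_edges_def by (metis (no_types, lifting) comp_apply map_cong map_map)
qed

section \<open>Darts and faces of a regular cubic rotation\<close>

lemma opp_opp [simp]: "opp (opp d) = d" and fst_opp [simp]: "fst (opp d) = fst d"
  and opp_neq [simp]: "opp d \<noteq> d"
  by (auto simp: opp_def prod_eq_iff)

lemma fst_eq_iff_opp: "fst c = fst d \<longleftrightarrow> c = d \<or> c = opp d"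
  by (cases c; cases d) (auto simp: opp_def)

lemma opp_eq_iff: "opp c = d \<longleftrightarrow> c = opp d"
  by auto

locale cubic_regular =
  fixes \<sigma> :: "('e::finite) rotation"
  assumes cubic: "\<sigma> (\<sigma> (\<sigma> d)) = d" and regular: "regular_graph \<sigma>"
begin

abbreviation "\<phi> \<equiv> face_step \<sigma>"

lemma inj_rotation: "inj \<sigma>"
  using cubic by (metis injI)

text \<open>As the third iterate of \<open>\<sigma>\<close> is the identity, the inverse of
  \<open>\<sigma>\<close> is its square.\<close>

lemma face_step_eq: "\<phi> d = \<sigma> (\<sigma> (opp d))"
  unfolding face_step_def using cubic inv_into_f_f[OF inj_rotation, of "\<sigma> (\<sigma> (opp d))"] by simp

lemma inj_face_step: "inj \<phi>"
  by (rule injI) (metis face_step_eq inj_rotation injD opp_opp)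

lemma permutation_face_step: "permutation \<phi>"
  using inj_face_step finite_UNIV_inj_surj[OF _ inj_face_step] by (simp add: permutation bij_def)

text \<open>All darts of a cycle have the same orbit, so a dart together with its reverse would put
  one face on both sides of an edge, against regularity.\<close>

lemma opp_notin_face:
  assumes "cyclic_list \<phi> ds" "d \<in> set ds"
  shows "opp d \<notin> set ds"
proof
  assume "opp d \<in> set ds"
  obtain c cs where ds: "ds = c # cs" using assms by (cases ds) auto
  have c: "orbit \<phi> c = set ds" using orbit_cyclic_list assms ds by metis
  have "orbit \<phi> x = set ds" if "x \<in> set ds" for x
    using that c cyclic_on_orbit'[OF permutation_face_step, of c] orbit_cyclic_eq3 by metis
  with assms(2) \<open>opp d \<in> set ds\<close> regular show False by (metis regular_graph_def)
qed

lemma distinct_face_edges: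
  assumes "cyclic_list \<phi> ds"
  shows "distinct (map fst ds)"
  using assms opp_notin_face[OF assms] fst_eq_iff_opp
  unfolding distinct_map cyclic_list_def inj_on_def by metis

text \<open>If \<open>d\<close> bounded a face alone, then \<open>d\<close>, \<open>opp d\<close>
  and a third dart \<open>c\<close> would form one vertex, and \<open>\<phi>\<close> would lead from
  \<open>opp c\<close> over \<open>opp d\<close> to \<open>c\<close>: the edge of \<open>c\<close>
  would have one face on both sides.\<close>

lemma face_step_neq: "\<phi> d \<noteq> d"
proof
  assume "\<phi> d = d"
  then have d: "\<sigma> d = opp d" using cubic by (metis face_step_eq)
  let ?c = "\<sigma> (opp d)"
  have "\<phi> (opp ?c) = opp d" "\<phi> (opp d) = ?c"
    using d by (simp_all add: face_step_eq cubic)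
  then have "?c \<in> orbit \<phi> (opp ?c)"
    using orbit.step[OF orbit.base, of \<phi> "opp ?c"] by simp
  moreover have "?c \<in> orbit \<phi> ?c" "opp ?c \<in> orbit \<phi> (opp ?c)"
    by (rule permutation_self_in_orbit[OF permutation_face_step])+
  moreover have "cyclic_on \<phi> (orbit \<phi> (opp ?c))" 
    by (rule cyclic_on_orbit'[OF permutation_face_step])
  ultimately have "orbit \<phi> ?c = orbit \<phi> (opp ?c)" by (metis orbit_cyclic_eq3)
  then show False using regular by (metis regular_graph_def)
qed

lemma cyclic_list_faceD:
  assumes "cyclic_list \<phi> (d # ds)"
  shows "ds \<noteq> []" "\<phi> (last ds) = d" "hd ds = \<phi> d"
proof -
  have m: "\<phi> d # map \<phi> ds = ds @ [d]" using assms by (simp add: cyclic_list_def)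
  then show ne: "ds \<noteq> []" using face_step_neq[of d] by auto
  from m ne show "hd ds = \<phi> d" by (cases ds) auto
  have "last (\<phi> d # map \<phi> ds) = \<phi> (last ds)" using ne by (simp add: last_map)
  with m show "\<phi> (last ds) = d" by simp
qed

lemma obtain_face:
  obtains ds where "cyclic_list \<phi> (d # ds)"
  using ex_cyclic_list[OF permutation_face_step] by metis

end

section \<open>Independence of the starting edge\<close>

lemma lookup_edge_vec: "Poly_Mapping.lookup (edge_vec e) e' = (if e = e' then 1 else 0)"
  by (simp add: edge_vec_def lookup_single when_def)

lemma edge_sum_simps [simp]:
  "edge_sum [] = 0" "edge_sum (e # es) = edge_vec e + edge_sum es"
  "edge_sum (es @ fs) = edge_sum es + edge_sum fs"
  by (simp_all add: edge_sum_def)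

lemma lookup_edge_sum:
  "distinct es \<Longrightarrow> Poly_Mapping.lookup (edge_sum es) e = (if e \<in> set es then 1 else 0)"
  by (induction es) (auto simp: lookup_add lookup_edge_vec)

context cubic_regular
begin

text \<open>At each end of the edge the successor counts positively and the predecessor, which is
  \<open>\<sigma>\<close> applied twice, negatively.\<close>

lemma form_edge_vec:
  "form \<sigma> (edge_vec (fst d)) w = Poly_Mapping.lookup w (fst (\<sigma> d)) - Poly_Mapping.lookup w (fst (\<sigma> (\<sigma> d)))
    + Poly_Mapping.lookup w (fst (\<sigma> (opp d))) - Poly_Mapping.lookup w (fst (\<sigma> (\<sigma> (opp d))))"
proof -
  let ?w = "Poly_Mapping.lookup w"
  have bij: "bij \<sigma>" using inj_rotation by (simp add: finite_UNIV_inj_surj bij_def)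
  have darts: "{c. fst c = fst d} = {d, opp d}" by (auto simp: fst_eq_iff_opp)
  have "form \<sigma> (edge_vec (fst d)) w = (\<Sum>c\<in>UNIV. (if fst c = fst d then ?w (fst (\<sigma> c)) else 0)) -
     (\<Sum>c\<in>UNIV. (if fst (\<sigma> c) = fst d then ?w (fst c) else 0))"
    unfolding form_eq_sum_darts sum_subtractf[symmetric] by (intro sum.cong refl) (auto simp: lookup_edge_vec)
  \<comment> \<open>Reindexing by the square of \<open>\<sigma>\<close> makes the condition one on
    \<open>c\<close> itself, so that this sum too runs over the two darts of the edge.\<close>
  also have "(\<Sum>c\<in>UNIV. (if fst (\<sigma> c) = fst d then ?w (fst c) else 0))
     = (\<Sum>c\<in>UNIV. (if fst (\<sigma> (\<sigma> (\<sigma> c))) = fst d then ?w (fst (\<sigma> (\<sigma> c))) else 0))"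
    by (rule sum.reindex_bij_betw[symmetric, of "\<lambda>c. \<sigma> (\<sigma> c)"]) (use bij_comp[OF bij bij] in \<open>simp add: comp_def\<close>)
  finally show ?thesis
    by (simp add: cubic sum.If_cases darts opp_neq[symmetric])
qed

text \<open>Of the four neighbours of the edge of \<open>d\<close>, two belong to this face.
  \<open>\<sigma> d\<close> is the reverse of the last dart, which enters the partial sum only at
  \<open>k = length ds\<close> and counts +1; \<open>\<phi> d\<close> enters as soon as
  \<open>k\<close> is positive and counts -1.\<close>

lemma form_face_prefix:
  assumes ds: "cyclic_list \<phi> (d # ds)" and k: "k \<le> length ds"
  shows "form \<sigma> (edge_vec (fst d)) (edge_sum (map fst (take k ds))) =
    (if k = 0 \<or> k = length ds then 0 else - 1)"
proof -
  let ?S = "set (d # ds)" and ?w = "Poly_Mapping.lookup (edge_sum (map fst (take k ds)))"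
  note ne = cyclic_list_faceD(1)[OF ds] and last = cyclic_list_faceD(2)[OF ds]
    and hd = cyclic_list_faceD(3)[OF ds]
  have dist: "distinct ds" and "d \<notin> set ds" using ds by (auto simp: cyclic_list_def)
  note step = cyclic_list_step_iff[OF ds inj_face_step]
  note opp = opp_notin_face[OF ds]
  have sub: "set (take k ds) \<subseteq> ?S" using set_take_subset by fastforce
  have w: "?w (fst c) = (if c \<in> set (take k ds) \<or> opp c \<in> set (take k ds) then 1 else 0)" for c
  proof -
    have "distinct (map fst (take k ds))" 
      using distinct_take[of "map fst ds" k] distinct_face_edges[OF ds] by (simp add: take_map)
    moreover have "fst c \<in> fst ` set (take k ds) \<longleftrightarrow> c \<in> set (take k ds) \<or> opp c \<in> set (take k ds)"
      unfolding image_iff fst_eq_iff_opp by (metis opp_opp)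
    ultimately show ?thesis by (simp add: lookup_edge_sum)
  qed
  have w0: "?w (fst c) = 0" if "c \<notin> ?S" "opp c \<notin> ?S" for c
    using that sub w by (meson subsetD)
  have lastS: "last ds \<in> ?S" and hdS: "\<phi> d \<in> ?S" using ne hd hd_in_set[OF ne] by auto
  have sd: "\<sigma> d = opp (last ds)" using last cubic by (metis face_step_eq)
  have "last ds \<in> set (take k ds) \<longleftrightarrow> k = length ds"
  proof
    assume "last ds \<in> set (take k ds)"
    then obtain i where "i < k" "ds ! i = ds ! (length ds - 1)" "i < length ds"
      using ne by (auto simp: in_set_conv_nth last_conv_nth)
    then have "i = length ds - 1" using dist nth_eq_iff_index_eq[of ds i "length ds - 1"] by auto
    then show "k = length ds" using \<open>i < k\<close> k by simp
  qed (use ne in auto)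
  moreover have "opp (last ds) \<notin> set (take k ds)" using opp[OF lastS] sub by blast
  ultimately have 1: "?w (fst (\<sigma> d)) = (if k = length ds then 1 else 0)"
    by (simp add: w sd)
  \<comment> \<open>For this neighbour and the next one: one step of \<open>\<phi>\<close>, forwards
    or backwards, links the dart and its reverse to reverses of darts of the face, which regularity
    keeps off the face.\<close>
  have 2: "?w (fst (\<sigma> (\<sigma> d))) = 0"
  proof (rule w0)
    show "\<sigma> (\<sigma> d) \<notin> ?S"
      using opp[of d] step[of "opp d"] by (simp add: face_step_eq)
    show "opp (\<sigma> (\<sigma> d)) \<notin> ?S"
      using opp[OF lastS] step[of "opp (\<sigma> (\<sigma> d))"] by (simp add: face_step_eq cubic sd)
  qed
  have 3: "?w (fst (\<sigma> (opp d))) = 0"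
  proof (rule w0)
    show "opp (\<sigma> (opp d)) \<notin> ?S"
      using opp[of d] step[of "opp (\<sigma> (opp d))"] by (simp add: face_step_eq cubic)
    show "\<sigma> (opp d) \<notin> ?S"
      using opp[OF hdS] step[of "opp (\<phi> d)"] by (simp add: face_step_eq cubic)
  qed
  have "\<phi> d \<in> set (take k ds) \<longleftrightarrow> k \<noteq> 0" using ne hd by (cases ds; cases k) auto
  moreover have "opp (\<phi> d) \<notin> set (take k ds)" using opp[OF hdS] sub by blast
  ultimately have 4: "?w (fst (\<sigma> (\<sigma> (opp d)))) = (if k \<noteq> 0 then 1 else 0)"
    by (simp add: w face_step_eq)
  show ?thesis using ne unfolding form_edge_vec 1 2 3 4 by auto
qed

lemma face_edges_step: "face_edges \<sigma> (\<phi> d) = rotate1 (face_edges \<sigma> d)"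
proof -
  obtain ds where ds: "cyclic_list \<phi> (d # ds)" by (rule obtain_face)
  have "rotate1 (d # ds) = \<phi> d # tl ds @ [d]" using cyclic_list_faceD[OF ds] by (cases ds) auto
  moreover from this have "cyclic_list \<phi> (\<phi> d # tl ds @ [d])" using cyclic_list_rotate1[OF ds] by metis
  ultimately show ?thesis
    using face_edges_cyclic_list[OF ds] face_edges_cyclic_list by (metis rotate1_map)
qed

lemma face_relation_step: "face_relation \<sigma> (\<phi> d) = face_relation \<sigma> d"
  unfolding face_relation_def face_edges_step by (cases "face_edges \<sigma> d") (simp_all add: add.commute)

text \<open>The left factor turns the constant q^(-1) into the first partial sum and lengthens the
  other sums by the edge of \<open>d\<close>. By \<open>form_face_prefix\<close> the powers of q
  cancel except in the last term, which becomes q times the monomial of the whole face; the face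
  relation trades it for the constant q^(-1).\<close>

lemma R_face_step:
  "torus_mult \<sigma> (monomial (qpow 1) (edge_vec (fst d))) (R_face \<sigma> (\<phi> d)) =
   R_face \<sigma> d + torus_mult \<sigma> (scalar (qpow 1)) (face_relation \<sigma> d)"
proof -
  obtain ds where ds: "cyclic_list \<phi> (d # ds)" by (rule obtain_face)
  note ne = cyclic_list_faceD(1)[OF ds]
  define e where "e = fst d"
  define S where "S k = edge_sum (map fst (take k ds))" for k
  define m where "m = length ds - 1"
  have m: "length ds = Suc m" using ne by (simp add: m_def)
  have fe: "face_edges \<sigma> d = e # map fst ds" using face_edges_cyclic_list[OF ds] by (simp add: e_def)
  have R: "R_face \<sigma> d = scalar (qpow (- 1)) + (\<Sum>k\<in>{0..<Suc m}. X (edge_vec e + S k))"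
  proof -
    have "(\<Sum>k\<in>{1..<length (face_edges \<sigma> d)}. X (edge_sum (take k (face_edges \<sigma> d)))) =
      (\<Sum>k\<in>{Suc 0..<Suc (Suc m)}. X (edge_sum (take k (face_edges \<sigma> d))))"
      by (simp add: fe m)
    also have "\<dots> = (\<Sum>k\<in>{0..<Suc m}. X (edge_vec e + S k))"
      unfolding sum.shift_bounds_Suc_ivl by (simp add: fe S_def take_map)
    finally show ?thesis by (simp add: R_face_def)
  qed
  have R': "R_face \<sigma> (\<phi> d) = scalar (qpow (- 1)) + (\<Sum>k\<in>{Suc 0..<Suc (Suc m)}. X (S k))"
  proof -
    have "(\<Sum>k\<in>{1..<length (face_edges \<sigma> (\<phi> d))}. X (edge_sum (take k (face_edges \<sigma> (\<phi> d))))) =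
      (\<Sum>k\<in>{Suc 0..<Suc (Suc m)}. X (edge_sum (take k (face_edges \<sigma> (\<phi> d)))))"
      by (simp add: face_edges_step fe m)
    \<comment> \<open>Here \<open>k\<close> is at most \<open>length ds\<close>, so the partial sums
      of the rotated list stop before the edge of \<open>d\<close>, now the last one.\<close>
    also have "\<dots> = (\<Sum>k\<in>{Suc 0..<Suc (Suc m)}. X (S k))"
      by (intro sum.cong refl) (simp add: face_edges_step fe S_def take_map m)
    finally show ?thesis by (simp add: R_face_def)
  qed
  have form: "form \<sigma> (edge_vec e) (S k) = (if k = 0 \<or> k = Suc m then 0 else - 1)" if "k \<le> Suc m" for k
    using form_face_prefix[OF ds, of k] that by (simp add: e_def S_def m)
  let ?T = "\<Sum>k\<in>{Suc 0..<Suc m}. X (edge_vec e + S k)"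
  have "torus_mult \<sigma> (monomial (qpow 1) (edge_vec e)) (R_face \<sigma> (\<phi> d)) =
    X (edge_vec e) + (\<Sum>k\<in>{Suc 0..<Suc (Suc m)}. monomial (qpow (1 + form \<sigma> (edge_vec e) (S k))) (edge_vec e + S k))"
    unfolding R' torus_mult_add_right torus_mult_sum_right torus_mult_monomial by (simp add: qpow_simps)
  also have "(\<Sum>k\<in>{Suc 0..<Suc (Suc m)}. monomial (qpow (1 + form \<sigma> (edge_vec e) (S k))) (edge_vec e + S k))
    = ?T + monomial (qpow 1) (edge_vec e + S (Suc m))"
  proof -
    have "(\<Sum>k\<in>{Suc 0..<Suc m}. monomial (qpow (1 + form \<sigma> (edge_vec e) (S k))) (edge_vec e + S k)) = ?T"
      by (intro sum.cong refl) (auto simp: form)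
    then show ?thesis
      by (subst sum.atLeastLessThan_Suc) (simp_all add: form del: sum.op_ivl_Suc)
  qed
  finally have lhs: "torus_mult \<sigma> (monomial (qpow 1) (edge_vec e)) (R_face \<sigma> (\<phi> d)) =
    X (edge_vec e) + ?T + monomial (qpow 1) (edge_vec e + S (Suc m))" by (simp add: add.assoc)
  have F: "face_relation \<sigma> d = X (edge_vec e + S (Suc m)) - scalar (qpow (- 2))"
    by (simp add: face_relation_def fe S_def flip: m)
  have "torus_mult \<sigma> (scalar (qpow 1)) (face_relation \<sigma> d) = monomial (qpow 1) (edge_vec e + S (Suc m)) - scalar (qpow (- 1))"
    unfolding F torus_mult_diff_right torus_mult_monomial by (simp add: qpow_simps)
  moreover have "R_face \<sigma> d = scalar (qpow (- 1)) + X (edge_vec e) + ?T"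
    unfolding R by (subst sum.atLeast_Suc_lessThan) (simp_all add: S_def add.assoc)
  ultimately show ?thesis using lhs by (simp add: e_def)
qed

text \<open>\<open>R_face_step\<close> writes \<open>R_face\<close> at \<open>d\<close> as a left
  multiple of \<open>R_face\<close> at \<open>\<phi> d\<close> minus a left multiple of the face
  relation, which is the same for both darts.\<close>

lemma face_relations_step:
  assumes "ring S" "h \<in> ring_hom (quantum_torus \<sigma>) S" "left_ideal S J"
    and "h (face_relation \<sigma> (\<phi> d)) \<in> J" "h (R_face \<sigma> (\<phi> d)) \<in> J"
  shows "h (face_relation \<sigma> d) \<in> J \<and> h (R_face \<sigma> d) \<in> J"
proof
  show fr: "h (face_relation \<sigma> d) \<in> J" using assms(4) by (simp add: face_relation_step)
  note h = ring_hom_memE[OF assms(2), simplified]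
  have "h (R_face \<sigma> d) \<oplus>\<^bsub>S\<^esub> h (scalar (qpow 1)) \<otimes>\<^bsub>S\<^esub> h (face_relation \<sigma> d) =
      h (monomial (qpow 1) (edge_vec (fst d))) \<otimes>\<^bsub>S\<^esub> h (R_face \<sigma> (\<phi> d))"
    unfolding h(2,3)[symmetric] R_face_step ..
  then show "h (R_face \<sigma> d) \<in> J"
    using left_ideal_add_cancel[OF assms(1,3)] left_ideal_mult[OF assms(1,3)] h(1) fr assms(5) by metis
qed

lemma face_relations_orbit:
  assumes "ring S" "h \<in> ring_hom (quantum_torus \<sigma>) S" "left_ideal S J"
    and d: "h (face_relation \<sigma> d) \<in> J" "h (R_face \<sigma> d) \<in> J" and d': "d' \<in> orbit \<phi> d"
  shows "h (face_relation \<sigma> d') \<in> J \<and> h (R_face \<sigma> d') \<in> J"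
proof -
  \<comment> \<open>\<open>face_relations_step\<close> goes backwards, from \<open>\<phi> d\<close>
    to \<open>d\<close>. So \<open>d\<close> is viewed as a point of the orbit of \<open>d'\<close>,
    and induction along that orbit brings membership back to \<open>d'\<close>.\<close>
  have "d \<in> orbit \<phi> d'"
    using d' permutation_self_in_orbit[OF permutation_face_step] by (metis orbit_swap)
  then show ?thesis using d
  proof (induction d)
    case base
    then show ?case using face_relations_step[OF assms(1-3)] by blast
  next
    case (step x)
    then show ?case using face_relations_step[OF assms(1-3)] by blast
  qed
qed

end

section \<open>Faces around a flipped edge\<close>

text \<open>All darts around the flipped edge are parameters, so that turning the picture is a
  renaming of them.\<close>

locale flip =
  \<Gamma>: cubic_regular \<sigma> + \<Gamma>': cubic_regular \<sigma>' for \<sigma> \<sigma>' :: "('e::finite) rotation" +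
  fixes l r t b d\<^sub>1 d\<^sub>2 d\<^sub>3 d\<^sub>4 :: "'e dart"
  assumes r: "r = opp l" and b: "b = opp t" and fst_t: "fst t = fst l"
    and distinct_edges: "distinct [fst l, fst d\<^sub>1, fst d\<^sub>2, fst d\<^sub>3, fst d\<^sub>4]"
    and \<sigma>: "\<sigma> l = d\<^sub>1" "\<sigma> d\<^sub>1 = d\<^sub>2" "\<sigma> d\<^sub>2 = l" "\<sigma> r = d\<^sub>3" "\<sigma> d\<^sub>3 = d\<^sub>4" "\<sigma> d\<^sub>4 = r"
    and \<sigma>': "\<sigma>' t = d\<^sub>4" "\<sigma>' d\<^sub>4 = d\<^sub>1" "\<sigma>' d\<^sub>1 = t" "\<sigma>' b = d\<^sub>2" "\<sigma>' d\<^sub>2 = d\<^sub>3" "\<sigma>' d\<^sub>3 = b"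
    and \<sigma>'_eq: "d \<notin> {l, r, d\<^sub>1, d\<^sub>2, d\<^sub>3, d\<^sub>4} \<Longrightarrow> \<sigma>' d = \<sigma> d"
begin

abbreviation "E\<^sub>0 \<equiv> {fst l, fst d\<^sub>1, fst d\<^sub>2, fst d\<^sub>3, fst d\<^sub>4}"
abbreviation "\<phi> \<equiv> face_step \<sigma>"
abbreviation "\<phi>' \<equiv> face_step \<sigma>'"

lemma tb: "t = l \<and> b = r \<or> t = r \<and> b = l"
  using fst_t fst_eq_iff_opp[of t l] r b by auto

lemma \<phi>_simps:
  "\<phi> (opp d\<^sub>1) = l" "\<phi> l = d\<^sub>4" "\<phi> (opp d\<^sub>3) = r" "\<phi> r = d\<^sub>2" "\<phi> (opp d\<^sub>2) = d\<^sub>1" "\<phi> (opp d\<^sub>4) = d\<^sub>3"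
  using \<sigma> r by (simp_all add: \<Gamma>.face_step_eq)

lemma \<phi>'_simps:
  "\<phi>' (opp d\<^sub>1) = d\<^sub>4" "\<phi>' (opp d\<^sub>3) = d\<^sub>2" "\<phi>' (opp d\<^sub>2) = b" "\<phi>' b = d\<^sub>1" "\<phi>' (opp d\<^sub>4) = t" "\<phi>' t = d\<^sub>3"
  using \<sigma>' b by (simp_all add: \<Gamma>'.face_step_eq)

text \<open>A step along \<open>x\<close> depends only on the rotation at the far end of
  \<open>x\<close>. The excluded darts are the reverses of the six darts at the two vertices that
  are rebuilt.\<close>

lemma \<phi>'_eq:
  assumes "x \<notin> {l, r, opp d\<^sub>1, opp d\<^sub>2, opp d\<^sub>3, opp d\<^sub>4}"
  shows "\<phi>' x = \<phi> x"
proof -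
  have 1: "opp x \<notin> {l, r, d\<^sub>1, d\<^sub>2, d\<^sub>3, d\<^sub>4}"
    using assms r by (auto simp: opp_eq_iff)
  have "\<sigma> (opp x) \<notin> {l, r, d\<^sub>1, d\<^sub>2, d\<^sub>3, d\<^sub>4}"
  proof
    assume "\<sigma> (opp x) \<in> {l, r, d\<^sub>1, d\<^sub>2, d\<^sub>3, d\<^sub>4}"
    then have "\<sigma> (\<sigma> (\<sigma> (opp x))) \<in> {l, r, d\<^sub>1, d\<^sub>2, d\<^sub>3, d\<^sub>4}" using \<sigma> by auto
    with 1 show False by (simp add: \<Gamma>.cubic)
  qed
  with 1 show ?thesis by (simp add: \<Gamma>.face_step_eq \<Gamma>'.face_step_eq \<sigma>'_eq)
qed

text \<open>
  A quarter of a turn of the picture interchanges the two graphs, so that the lemma \<open>top_face\<close>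
  below covers all four faces at the flipped edge.
\<close>

lemma flip_quarter_turn: "flip \<sigma>' \<sigma> t b r l d\<^sub>4 d\<^sub>1 d\<^sub>2 d\<^sub>3"
proof
  show "\<sigma> d = \<sigma>' d" if "d \<notin> {t, b, d\<^sub>4, d\<^sub>1, d\<^sub>2, d\<^sub>3}" for d
    using that tb by (intro \<sigma>'_eq[symmetric]) auto
qed (use \<sigma> \<sigma>' r b fst_t distinct_edges in \<open>auto simp: fst_t\<close>)

text \<open>The face of \<open>l\<close> reads \<open>l\<close>, \<open>d\<^sub>4\<close>, ...,
  \<open>opp d\<^sub>1\<close>. After the flip \<open>opp d\<^sub>1\<close> is followed directly by
  \<open>d\<^sub>4\<close>, so \<open>l\<close> drops out; the steps in between are unchanged since
  the other darts excluded in \<open>\<phi>'_eq\<close> are off this face.\<close>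

lemma top_face:
  obtains es where "face_edges \<sigma> l = fst l # fst d\<^sub>4 # es @ [fst d\<^sub>1]"
    "face_edges \<sigma>' d\<^sub>4 = fst d\<^sub>4 # es @ [fst d\<^sub>1]" "distinct es" "set es \<inter> E\<^sub>0 = {}"
    "opp d\<^sub>1 \<in> orbit \<phi> l" "d\<^sub>4 \<in> orbit \<phi> l" "opp d\<^sub>1 \<in> orbit \<phi>' d\<^sub>4"
proof -
  obtain ds where ds: "cyclic_list \<phi> (l # ds)" by (rule \<Gamma>.obtain_face)
  note ds' = \<Gamma>.cyclic_list_faceD[OF ds]
  let ?S = "set (l # ds)"
  note step = cyclic_list_step_iff[OF ds \<Gamma>.inj_face_step]
  note opp = \<Gamma>.opp_notin_face[OF ds]
  have last: "last ds = opp d\<^sub>1"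
    using ds'(2) \<phi>_simps(1) \<Gamma>.inj_face_step by (metis injD)
  have neq: "opp d\<^sub>1 \<noteq> d\<^sub>4" using distinct_edges by auto
  obtain cs where cs: "ds = d\<^sub>4 # cs @ [opp d\<^sub>1]"
  proof -
    obtain ds0 where "ds = ds0 @ [opp d\<^sub>1]" using ds'(1) last append_butlast_last_id by metis
    moreover obtain cs where "ds0 = d\<^sub>4 # cs"
      using ds'(3) neq calculation \<phi>_simps(2) by (cases ds0) auto
    ultimately show ?thesis using that by simp
  qed
  have in_S: "l \<in> ?S" "d\<^sub>4 \<in> ?S" "opp d\<^sub>1 \<in> ?S" using cs by auto
  have r': "r \<notin> ?S" and 4: "opp d\<^sub>4 \<notin> ?S" and 1: "d\<^sub>1 \<notin> ?S"
    using opp[OF in_S(1)] opp[OF in_S(2)] opp[OF in_S(3)] r by auto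
  \<comment> \<open>A face is closed under steps in both directions, and one step links each of
    these darts to \<open>r\<close>, \<open>d\<^sub>1\<close> or \<open>opp d\<^sub>4\<close>,
    already known to be off the face.\<close>
  have 2: "d\<^sub>2 \<notin> ?S" "opp d\<^sub>2 \<notin> ?S" and 3: "d\<^sub>3 \<notin> ?S" "opp d\<^sub>3 \<notin> ?S"
    using step[of r] step[of "opp d\<^sub>2"] step[of "opp d\<^sub>4"] step[of "opp d\<^sub>3"] r' 4 1
    unfolding \<phi>_simps by simp_all
  have dist: "distinct (l # d\<^sub>4 # cs @ [opp d\<^sub>1])" using ds cs by (simp add: cyclic_list_def)
  have "\<phi>' x = \<phi> x" if "x \<in> set (d\<^sub>4 # cs)" for x
  proof (rule \<phi>'_eq)
    have "x \<in> ?S" "x \<noteq> l" "x \<noteq> opp d\<^sub>1" using that cs dist by auto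
    then show "x \<notin> {l, r, opp d\<^sub>1, opp d\<^sub>2, opp d\<^sub>3, opp d\<^sub>4}" using r' 2 3 4 by (metis empty_iff insert_iff)
  qed
  then have "map \<phi>' (d\<^sub>4 # cs) = map \<phi> (d\<^sub>4 # cs)" by (metis map_cong)
  moreover have "map \<phi> (d\<^sub>4 # cs) = cs @ [opp d\<^sub>1]"
    using ds cs by (simp add: cyclic_list_def)
  ultimately have "map \<phi>' ((d\<^sub>4 # cs) @ [opp d\<^sub>1]) = (cs @ [opp d\<^sub>1]) @ [d\<^sub>4]"
    using \<phi>'_simps(1) by (simp only: map_append list.map)
  then have ds'': "cyclic_list \<phi>' (d\<^sub>4 # cs @ [opp d\<^sub>1])"
    using dist by (simp add: cyclic_list_def)
  have disj: "distinct (map fst (l # ds))" by (rule \<Gamma>.distinct_face_edges[OF ds])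
  have "fst x \<notin> E\<^sub>0" if "x \<in> set cs" for x
  proof -
    have "x \<in> ?S" using that cs by simp
    then have "fst x \<noteq> fst d\<^sub>2" "fst x \<noteq> fst d\<^sub>3"
      using 2 3 by (metis fst_eq_iff_opp)+
    moreover have "fst l \<notin> fst ` set cs" "fst d\<^sub>1 \<notin> fst ` set cs" "fst d\<^sub>4 \<notin> fst ` set cs"
      using disj unfolding cs by simp_all
    then have "fst x \<notin> {fst l, fst d\<^sub>1, fst d\<^sub>4}" 
      using imageI[OF that, of fst] by (metis empty_iff insert_iff)
    ultimately show ?thesis by simp
  qed
  then have "set (map fst cs) \<inter> E\<^sub>0 = {}" unfolding set_map by blast
  moreover have "distinct (map fst cs)" using disj cs by simp
  ultimately show ?thesis
    using that[of "map fst cs"] face_edges_cyclic_list[OF ds] face_edges_cyclic_list[OF ds'']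
      orbit_cyclic_list[OF ds] orbit_cyclic_list[OF ds''] cs by simp
qed

lemma other_face:
  assumes "\<And>x. x \<in> orbit \<phi> d \<Longrightarrow> fst x \<notin> E\<^sub>0"
  shows "face_edges \<sigma>' d = face_edges \<sigma> d" "orbit \<phi>' d = orbit \<phi> d"
    "distinct (face_edges \<sigma> d)" "set (face_edges \<sigma> d) \<inter> E\<^sub>0 = {}"
proof -
  obtain ds where ds: "cyclic_list \<phi> (d # ds)" by (rule \<Gamma>.obtain_face)
  note orb = orbit_cyclic_list[OF ds]
  have "\<phi>' x = \<phi> x" if "x \<in> set (d # ds)" for x
  proof (rule \<phi>'_eq)
    have "fst x \<notin> E\<^sub>0" using assms that orb by blast
    then show "x \<notin> {l, r, opp d\<^sub>1, opp d\<^sub>2, opp d\<^sub>3, opp d\<^sub>4}" using r by auto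
  qed
  then have "map \<phi>' (d # ds) = map \<phi> (d # ds)" by (metis map_cong)
  then have ds': "cyclic_list \<phi>' (d # ds)" using ds by (metis cyclic_list_def)
  show "face_edges \<sigma>' d = face_edges \<sigma> d" "orbit \<phi>' d = orbit \<phi> d"
    using face_edges_cyclic_list[OF ds] face_edges_cyclic_list[OF ds'] orb orbit_cyclic_list[OF ds'] by simp_all
  show "distinct (face_edges \<sigma> d)"
    unfolding face_edges_cyclic_list[OF ds] by (rule \<Gamma>.distinct_face_edges[OF ds])
  show "set (face_edges \<sigma> d) \<inter> E\<^sub>0 = {}"
    unfolding face_edges_cyclic_list[OF ds] set_map using assms unfolding orb by blast
qed

end

section \<open>The mutation on the generators of the chromatic ideal\<close>

text \<open>\<open>\<kappa>\<close> will be \<open>\<mu>\<^sub>0 \<circ> \<iota>'\<close>: both tori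
  are mapped to the same ring \<open>L\<close>, where the generators are compared.\<close>

locale flip_mutation = flip + L: ring L for L (structure) +
  fixes \<iota> \<kappa> :: "'a torus \<Rightarrow> 'b"
  assumes \<iota>_hom: "\<iota> \<in> ring_hom (quantum_torus \<sigma>) L" and \<kappa>_hom: "\<kappa> \<in> ring_hom (quantum_torus \<sigma>') L"
    and \<iota>_ore: "s \<in> ore_set \<sigma> (fst l) \<Longrightarrow> \<iota> s \<in> Units L"
    and \<kappa>_scalar: "\<kappa> (scalar c) = \<iota> (scalar c)"
    and \<kappa>_edges:
      "\<kappa> (X (edge_vec (fst l))) = \<iota> (X (- edge_vec (fst l)))"
      "\<kappa> (X (edge_vec (fst d\<^sub>1))) = \<iota> (X (edge_vec (fst d\<^sub>1))) \<otimes> \<iota> (X 0 + monomial (qpow 1) (edge_vec (fst l)))"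
      "\<kappa> (X (edge_vec (fst d\<^sub>2))) = \<iota> (X (edge_vec (fst d\<^sub>2))) \<otimes> inv (\<iota> (X 0 + monomial (qpow 1) (- edge_vec (fst l))))"
      "\<kappa> (X (edge_vec (fst d\<^sub>3))) = \<iota> (X (edge_vec (fst d\<^sub>3))) \<otimes> \<iota> (X 0 + monomial (qpow 1) (edge_vec (fst l)))"
      "\<kappa> (X (edge_vec (fst d\<^sub>4))) = \<iota> (X (edge_vec (fst d\<^sub>4))) \<otimes> inv (\<iota> (X 0 + monomial (qpow 1) (- edge_vec (fst l))))"
      "e \<notin> E\<^sub>0 \<Longrightarrow> \<kappa> (X (edge_vec e)) = \<iota> (X (edge_vec e))"
begin

abbreviation "e\<^sub>0 \<equiv> fst l"
abbreviation "e\<^sub>1 \<equiv> fst d\<^sub>1"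
abbreviation "e\<^sub>2 \<equiv> fst d\<^sub>2"
abbreviation "e\<^sub>3 \<equiv> fst d\<^sub>3"
abbreviation "e\<^sub>4 \<equiv> fst d\<^sub>4"

lemmas \<iota>_mem = ring_hom_memE[OF \<iota>_hom, simplified]
lemmas \<kappa>_mem = ring_hom_memE[OF \<kappa>_hom, simplified]

lemmas [simp] = \<iota>_mem(1,4) \<kappa>_mem(1,4)

section \<open>The pairing with the flipped edge and the isometry of edge lattices\<close>

definition pairing :: "'a lattice \<Rightarrow> int" where
  "pairing v = Poly_Mapping.lookup v e\<^sub>1 - Poly_Mapping.lookup v e\<^sub>2 + Poly_Mapping.lookup v e\<^sub>3 - Poly_Mapping.lookup v e\<^sub>4"

text \<open>
  The monomial part of the mutation: \<open>X'\<^sub>v\<close> is sent to \<open>X\<^bsub>trop v\<^esub>\<close> times a function of \<open>X\<^bsub>e\<^sub>0\<^esub>\<close>,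
  where \<open>trop\<close> is an isometry between the two edge lattices.
\<close>

definition trop :: "'a lattice \<Rightarrow> 'a lattice" where
  "trop v = v + Poly_Mapping.single e\<^sub>0
     (Poly_Mapping.lookup v e\<^sub>2 + Poly_Mapping.lookup v e\<^sub>4 - 2 * Poly_Mapping.lookup v e\<^sub>0)"

lemma pairing_add: "pairing (v + w) = pairing v + pairing w"
  by (simp add: pairing_def lookup_add)

lemma trop_add: "trop (v + w) = trop v + trop w"
  by (simp add: trop_def lookup_add single_add[symmetric] algebra_simps)

lemma lookup_trop: "Poly_Mapping.lookup (trop v) e =
    (if e = e\<^sub>0 then Poly_Mapping.lookup v e\<^sub>2 + Poly_Mapping.lookup v e\<^sub>4 - Poly_Mapping.lookup v e\<^sub>0
     else Poly_Mapping.lookup v e)"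
  by (auto simp: trop_def lookup_add lookup_single)

lemma pairing_trop [simp]: "pairing (trop v) = pairing v"
  using distinct_edges by (auto simp: pairing_def lookup_trop)

text \<open>The four neighbours of \<open>e\<^sub>0\<close> in \<open>form_edge_vec\<close> are the
  four terms of \<open>pairing\<close>, which thus governs how monomials commute with
  \<open>X (edge_vec e\<^sub>0)\<close>.\<close>

lemma form_edge0_left: "form \<sigma> (edge_vec e\<^sub>0) v = pairing v"
  using \<sigma> r by (simp add: \<Gamma>.form_edge_vec pairing_def)

lemma form_edge0_right: "form \<sigma> v (edge_vec e\<^sub>0) = - pairing v"
  using form_edge0_left form_skew by metis

text \<open>Away from the six darts around \<open>e\<^sub>0\<close> the rotations agree and
  \<open>e\<^sub>0\<close> does not occur, so the dart sums agree term by term; the six remaining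
  terms are compared by direct computation.\<close>

lemma form_trop: "form \<sigma> (trop v) (trop w) = form \<sigma>' v w"
proof -
  let ?Darts = "{l, r, d\<^sub>1, d\<^sub>2, d\<^sub>3, d\<^sub>4}"
  define f where "f \<rho> v w d = Poly_Mapping.lookup v (fst d) * Poly_Mapping.lookup w (fst (\<rho> d))
    - Poly_Mapping.lookup w (fst d) * Poly_Mapping.lookup v (fst (\<rho> d))" for \<rho> :: "'a rotation" and v w :: "'a lattice" and d
  have form: "form \<rho> v w = sum (f \<rho> v w) (- ?Darts) + sum (f \<rho> v w) ?Darts" for \<rho> v w
    unfolding form_eq_sum_darts f_def[symmetric]
    by (subst sum.union_disjoint[symmetric]) (auto intro: sum.cong)
  have "sum (f \<sigma> (trop v) (trop w)) (- ?Darts) = sum (f \<sigma>' v w) (- ?Darts)"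
  proof (rule sum.cong[OF refl])
    fix d assume "d \<in> - ?Darts"
    then have d: "d \<notin> ?Darts" by blast
    have "\<sigma> d \<notin> ?Darts"
    proof
      assume "\<sigma> d \<in> ?Darts"
      then have "\<sigma> (\<sigma> (\<sigma> d)) \<in> ?Darts" using \<sigma> by auto
      with d show False by (simp add: \<Gamma>.cubic)
    qed
    with d have "fst d \<noteq> e\<^sub>0" "fst (\<sigma> d) \<noteq> e\<^sub>0" using fst_eq_iff_opp r by (metis insertCI)+
    then show "f \<sigma> (trop v) (trop w) d = f \<sigma>' v w d" using \<sigma>'_eq[OF d] by (simp add: f_def lookup_trop)
  qed
  moreover have "sum (f \<sigma> (trop v) (trop w)) ?Darts = sum (f \<sigma>' v w) ?Darts"
  proof -
    have dist: "distinct [l, r, d\<^sub>1, d\<^sub>2, d\<^sub>3, d\<^sub>4]" "distinct [t, b, d\<^sub>1, d\<^sub>2, d\<^sub>3, d\<^sub>4]"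
      using distinct_edges r b fst_t opp_neq[of l, symmetric] opp_neq[of t, symmetric] by auto
    have darts: "?Darts = set [l, r, d\<^sub>1, d\<^sub>2, d\<^sub>3, d\<^sub>4]" "?Darts = set [t, b, d\<^sub>1, d\<^sub>2, d\<^sub>3, d\<^sub>4]"
      using tb by auto
    have 1: "sum (f \<sigma> (trop v) (trop w)) ?Darts = sum_list (map (f \<sigma> (trop v) (trop w)) [l, r, d\<^sub>1, d\<^sub>2, d\<^sub>3, d\<^sub>4])"
      unfolding darts(1) using dist by (simp only: sum_list_distinct_conv_sum_set)
    have 2: "sum (f \<sigma>' v w) ?Darts = sum_list (map (f \<sigma>' v w) [t, b, d\<^sub>1, d\<^sub>2, d\<^sub>3, d\<^sub>4])"
      unfolding darts(2) using dist by (simp only: sum_list_distinct_conv_sum_set)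
    have "fst r = e\<^sub>0" "fst t = e\<^sub>0" "fst b = e\<^sub>0" using r b fst_t by simp_all
    moreover have "e\<^sub>1 \<noteq> e\<^sub>0" "e\<^sub>2 \<noteq> e\<^sub>0" "e\<^sub>3 \<noteq> e\<^sub>0" "e\<^sub>4 \<noteq> e\<^sub>0" using distinct_edges by auto
    ultimately show ?thesis
      unfolding 1 2 by (simp add: f_def lookup_trop \<sigma> \<sigma>' algebra_simps)
  qed
  ultimately show ?thesis by (simp add: form)
qed

section \<open>The factors 1 + q^j X at the flipped edge and their commutation rules\<close>

definition binom :: "int \<Rightarrow> 'a torus" where
  "binom j = X 0 + monomial (qpow j) (edge_vec e\<^sub>0)"

text \<open>The case distinction suffices because only partial sums with pairing in \<open>{-1, 0, 1}\<close> occur.\<close>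

definition dilog :: "int \<Rightarrow> 'b" where
  "dilog k = (if k = 1 then \<iota> (binom 1) else if k = - 1 then inv (\<iota> (binom (- 1))) else \<one>)"

lemma binom_Units: "odd j \<Longrightarrow> \<iota> (binom j) \<in> Units L"
proof (rule \<iota>_ore)
  assume "odd j"
  then obtain k where k: "j = 2 * k + 1" by (elim oddE)
  have "binom j = foldr (\<lambda>k s. (X 0 + monomial (qpow (2 * k + 1)) (edge_vec e\<^sub>0)) \<otimes>\<^bsub>quantum_torus \<sigma>\<^esub> s)
     [k] \<one>\<^bsub>quantum_torus \<sigma>\<^esub>"
    by (simp add: k binom_def torus_mult_add_left torus_mult_monomial)
  then show "binom j \<in> ore_set \<sigma> e\<^sub>0" unfolding ore_set_def by (rule range_eqI)
qed

lemma dilog_closed [simp]: "dilog k \<in> carrier L"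
  using binom_Units[of 1] binom_Units[of "- 1"] by (simp add: dilog_def)

lemma monomial_Units:
  shows "\<iota> (monomial (qpow k) v) \<in> Units L"
    and "inv (\<iota> (monomial (qpow k) v)) = \<iota> (monomial (qpow (- k)) (- v))"
proof -
  have 1: "\<iota> (monomial (qpow k) v) \<otimes> \<iota> (monomial (qpow (- k)) (- v)) = \<one>"
    and 2: "\<iota> (monomial (qpow (- k)) (- v)) \<otimes> \<iota> (monomial (qpow k) v) = \<one>"
    by (simp_all add: \<iota>_mem(2)[symmetric] torus_mult_monomial qpow_simps form_minus_left form_minus_right)
  then show "\<iota> (monomial (qpow k) v) \<in> Units L" by (auto simp: Units_def)
  show "inv (\<iota> (monomial (qpow k) v)) = \<iota> (monomial (qpow (- k)) (- v))"
    by (rule L.inv_unique'[symmetric]) (use 1 2 in simp_all)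
qed

text \<open>By skew symmetry \<open>X (edge_vec e\<^sub>0)\<close> and \<open>X v\<close> commute up
  to q raised to twice \<open>pairing v\<close>, which shifts the exponent \<open>j\<close>.\<close>

lemma binom_comm: "torus_mult \<sigma> (binom j) (X v) = torus_mult \<sigma> (X v) (binom (j + 2 * pairing v))"
  unfolding binom_def torus_mult_add_left torus_mult_add_right torus_mult_monomial
  by (simp add: qpow_simps form_edge0_left form_edge0_right add.commute)

lemma \<iota>_binom_comm: "\<iota> (binom j) \<otimes> \<iota> (X v) = \<iota> (X v) \<otimes> \<iota> (binom (j + 2 * pairing v))"
  by (simp add: \<iota>_mem(2)[symmetric] binom_comm)

lemma inv_comm:
  assumes "x \<in> Units L" "y \<in> Units L" "a \<in> carrier L" "x \<otimes> a = a \<otimes> y"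
  shows "inv x \<otimes> a = a \<otimes> inv y"
proof -
  have "inv x \<otimes> a = inv x \<otimes> (a \<otimes> y) \<otimes> inv y"
    using assms(1-3) by (simp add: L.m_assoc L.Units_closed)
  also have "\<dots> = inv x \<otimes> (x \<otimes> a) \<otimes> inv y" by (simp add: assms(4))
  also have "\<dots> = a \<otimes> inv y"
    using assms(1-3) by (simp add: L.m_assoc[symmetric] L.Units_closed)
  finally show ?thesis .
qed

lemma inv_mult_Units:
  assumes "x \<in> Units L" "y \<in> Units L"
  shows "inv (x \<otimes> y) = inv y \<otimes> inv x"
proof -
  have "y \<otimes> (inv y \<otimes> inv x) = inv x" "inv x \<otimes> (x \<otimes> y) = y"
    using assms by (simp_all add: L.m_assoc[symmetric] L.Units_closed)
  then have "x \<otimes> y \<otimes> (inv y \<otimes> inv x) = \<one>" "inv y \<otimes> inv x \<otimes> (x \<otimes> y) = \<one>"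
    using assms by (simp_all add: L.m_assoc L.Units_closed)
  then show ?thesis using assms by (intro L.inv_unique'[symmetric]) (simp_all add: L.Units_closed)
qed

lemma inv_binom_comm:
  "odd j \<Longrightarrow> inv (\<iota> (binom j)) \<otimes> \<iota> (X v) = \<iota> (X v) \<otimes> inv (\<iota> (binom (j + 2 * pairing v)))"
  by (rule inv_comm) (simp_all add: binom_Units \<iota>_binom_comm)

text \<open>The rule by which the factors of two monomials merge. If neither number is 0 they have
  opposite signs, and the exponent shift by 2 turns the left factor into the inverse of the right
  one.\<close>

lemma dilog_comm:
  assumes "m \<in> {-1, 0, 1}" "pairing v \<in> {-1, 0, 1}" "m + pairing v \<in> {-1, 0, 1}"
  shows "dilog m \<otimes> \<iota> (X v) \<otimes> dilog (pairing v) = \<iota> (X v) \<otimes> dilog (m + pairing v)"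
proof -
  note U = binom_Units[of 1, simplified] binom_Units[of "- 1", simplified]
  note assoc = L.m_assoc[OF \<iota>_mem(1)]
  have "m = 0 \<or> pairing v = 0 \<or> m = 1 \<and> pairing v = - 1 \<or> m = - 1 \<and> pairing v = 1"
    using assms by auto
  then show ?thesis
  proof (elim disjE)
    assume "pairing v = 0"
    then show ?thesis using assms(1) \<iota>_binom_comm[of 1 v] inv_binom_comm[of "- 1" v] U
      by (auto simp: dilog_def)
  next
    assume *: "m = 1 \<and> pairing v = - 1"
    then show ?thesis using \<iota>_binom_comm[of 1 v] U by (simp add: dilog_def assoc)
  next
    assume *: "m = - 1 \<and> pairing v = 1"
    then show ?thesis using inv_binom_comm[of "- 1" v] U by (simp add: dilog_def assoc)
  qed (use U in \<open>simp add: dilog_def\<close>)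
qed

section \<open>The images of monomials under the mutation\<close>

definition mutates :: "'a lattice \<Rightarrow> bool" where
  "mutates v \<longleftrightarrow> \<kappa> (X v) = \<iota> (X (trop v)) \<otimes> dilog (pairing v)"

lemma mutates_0: "mutates 0"
  by (simp add: mutates_def trop_def pairing_def dilog_def)

text \<open>\<open>X (v + w)\<close> is a power of q times a product. By \<open>form_trop\<close>
  the same power of q serves on the other side, and \<open>dilog_comm\<close> merges the two
  factors.\<close>

lemma mutates_add:
  assumes "mutates v" "mutates w" "pairing v \<in> {-1, 0, 1}" "pairing w \<in> {-1, 0, 1}" "pairing v + pairing w \<in> {-1, 0, 1}"
  shows "mutates (v + w)"
proof -
  let ?c = "scalar (qpow (- form \<sigma>' v w))"
  have "X (v + w) = torus_mult \<sigma>' ?c (torus_mult \<sigma>' (X v) (X w))"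
    by (simp add: torus_mult_monomial qpow_simps)
  then have "\<kappa> (X (v + w)) = \<iota> ?c \<otimes> (\<iota> (X (trop v)) \<otimes> dilog (pairing v) \<otimes> (\<iota> (X (trop w)) \<otimes> dilog (pairing w)))"
    using assms(1,2) by (simp add: \<kappa>_mem(2) \<kappa>_scalar mutates_def)
  also have "\<dots> = \<iota> ?c \<otimes> (\<iota> (X (trop v)) \<otimes> (dilog (pairing v) \<otimes> \<iota> (X (trop w)) \<otimes> dilog (pairing w)))"
    by (simp add: L.m_assoc)
  also have "dilog (pairing v) \<otimes> \<iota> (X (trop w)) \<otimes> dilog (pairing w) = \<iota> (X (trop w)) \<otimes> dilog (pairing v + pairing w)"
    using dilog_comm[of "pairing v" "trop w"] assms(3-5) by simp
  also have "\<iota> ?c \<otimes> (\<iota> (X (trop v)) \<otimes> (\<iota> (X (trop w)) \<otimes> dilog (pairing v + pairing w)))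
      = \<iota> (torus_mult \<sigma> ?c (torus_mult \<sigma> (X (trop v)) (X (trop w)))) \<otimes> dilog (pairing v + pairing w)"
    by (simp add: L.m_assoc \<iota>_mem(2))
  also have "torus_mult \<sigma> ?c (torus_mult \<sigma> (X (trop v)) (X (trop w))) = X (trop (v + w))"
    by (simp add: torus_mult_monomial qpow_simps form_trop trop_add)
  finally show ?thesis by (simp add: mutates_def pairing_add)
qed

text \<open>With X at \<open>e\<^sub>0\<close> written x, this rests on 1 + q x^(-1) = (1 + q^(-1)
  x) q x^(-1). The inverse splits into a monomial, which accounts for the shift by
  \<open>e\<^sub>0\<close> in \<open>trop\<close>, and the factor
  \<open>dilog (- 1)\<close>.\<close>

lemma inv_binom_neg: "inv (\<iota> (X 0 + monomial (qpow 1) (- edge_vec e\<^sub>0))) =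
    \<iota> (monomial (qpow (- 1)) (edge_vec e\<^sub>0)) \<otimes> inv (\<iota> (binom (- 1)))"
  and binom_neg_Units: "\<iota> (X 0 + monomial (qpow 1) (- edge_vec e\<^sub>0)) \<in> Units L"
proof -
  have "X 0 + monomial (qpow 1) (- edge_vec e\<^sub>0) = torus_mult \<sigma> (binom (- 1)) (monomial (qpow 1) (- edge_vec e\<^sub>0))"
    unfolding binom_def torus_mult_add_left torus_mult_monomial
    by (simp add: qpow_simps form_minus_right add.commute)
  then have eq: "\<iota> (X 0 + monomial (qpow 1) (- edge_vec e\<^sub>0)) =
      \<iota> (binom (- 1)) \<otimes> \<iota> (monomial (qpow 1) (- edge_vec e\<^sub>0))" by (simp add: \<iota>_mem(2))
  show "\<iota> (X 0 + monomial (qpow 1) (- edge_vec e\<^sub>0)) \<in> Units L"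
    unfolding eq by (intro L.Units_m_closed binom_Units monomial_Units) simp
  show "inv (\<iota> (X 0 + monomial (qpow 1) (- edge_vec e\<^sub>0))) =
      \<iota> (monomial (qpow (- 1)) (edge_vec e\<^sub>0)) \<otimes> inv (\<iota> (binom (- 1)))"
    unfolding eq using inv_mult_Units[OF binom_Units monomial_Units(1), of "- 1" 1 "- edge_vec e\<^sub>0"]
    by (simp add: monomial_Units(2))
qed

lemma mutates_edge: "mutates (edge_vec e)"
proof -
  note d = distinct_edges[simplified]
  have trop: "trop (edge_vec e) = (if e = e\<^sub>0 then - edge_vec e\<^sub>0
      else if e \<in> {e\<^sub>2, e\<^sub>4} then edge_vec e + edge_vec e\<^sub>0 else edge_vec e)" for e
    by (rule poly_mapping_eqI) (use d in \<open>auto simp: lookup_trop lookup_edge_vec lookup_add\<close>)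
  have pairing: "pairing (edge_vec e) = (if e \<in> {e\<^sub>1, e\<^sub>3} then 1 else if e \<in> {e\<^sub>2, e\<^sub>4} then - 1 else 0)" for e
    using d by (auto simp: pairing_def lookup_edge_vec)
  have neg: "\<iota> (X (edge_vec e)) \<otimes> inv (\<iota> (X 0 + monomial (qpow 1) (- edge_vec e\<^sub>0)))
      = \<iota> (X (edge_vec e + edge_vec e\<^sub>0)) \<otimes> inv (\<iota> (binom (- 1)))" if "pairing (edge_vec e) = - 1" for e
  proof -
    \<comment> \<open>Pairing -1 gives
      \<open>form \<sigma> (edge_vec e) (edge_vec e\<^sub>0)\<close> the value 1, which cancels the
      coefficient q^(-1).\<close>
    have "torus_mult \<sigma> (X (edge_vec e)) (monomial (qpow (- 1)) (edge_vec e\<^sub>0)) = X (edge_vec e + edge_vec e\<^sub>0)"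
      using that by (simp add: torus_mult_monomial qpow_simps form_edge0_right)
    then show ?thesis
      unfolding inv_binom_neg using binom_Units[of "- 1"] by (simp add: L.m_assoc[symmetric] \<iota>_mem(2)[symmetric])
  qed
  consider "e = e\<^sub>0" | "e = e\<^sub>1" | "e = e\<^sub>2" | "e = e\<^sub>3" | "e = e\<^sub>4" | "e \<notin> E\<^sub>0" by auto
  then show ?thesis
    using d by cases (auto simp: mutates_def trop pairing \<kappa>_edges dilog_def neg, simp_all add: binom_def)
qed

text \<open>Distinct edges including neither both positive edges \<open>e\<^sub>1\<close>,
  \<open>e\<^sub>3\<close> nor both negative edges \<open>e\<^sub>2\<close>,
  \<open>e\<^sub>4\<close> have pairing -1, 0 or 1. This passes to subsets, so edges can be added
  one at a time by \<open>mutates_add\<close>.\<close>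

lemma mutates_edge_sum:
  assumes "distinct es" "\<not> {e\<^sub>1, e\<^sub>3} \<subseteq> set es" "\<not> {e\<^sub>2, e\<^sub>4} \<subseteq> set es"
  shows "mutates (edge_sum es)"
  using assms
proof (induction es)
  case (Cons e es)
  have pairing: "pairing (edge_sum fs) \<in> {-1, 0, 1}" if "distinct fs" "\<not> {e\<^sub>1, e\<^sub>3} \<subseteq> set fs" "\<not> {e\<^sub>2, e\<^sub>4} \<subseteq> set fs" for fs
    using that by (auto simp: pairing_def lookup_edge_sum)
  have "pairing (edge_sum (e # es)) \<in> {-1, 0, 1}" "pairing (edge_sum es) \<in> {-1, 0, 1}" "pairing (edge_sum [e]) \<in> {-1, 0, 1}"
    using Cons.prems distinct_edges by (intro pairing; auto)+
  moreover have "mutates (edge_sum es)" using Cons by auto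
  ultimately show ?case using mutates_edge by (auto simp: pairing_add intro!: mutates_add)
qed (simp add: mutates_0)

section \<open>The images of the generators of the chromatic ideal\<close>

lemma \<kappa>_sum:
  assumes "finite K" "p \<in> carrier L" "\<And>k. k \<in> K \<Longrightarrow> \<kappa> (f k) = \<iota> (f' k) \<otimes> p"
  shows "\<kappa> (sum f K) = \<iota> (sum f' K) \<otimes> p"
  using assms(1,3)
proof (induction K rule: finite_induct)
  case empty
  have zero: "h 0 = \<zero>" if "h \<in> ring_hom (quantum_torus \<rho>) L" for h \<rho>
  proof -
    interpret h: abelian_group_hom "quantum_torus \<rho>" L h
      by (rule ring_hom_abelian_group_hom[OF abelian_group_quantum_torus L.abelian_group_axioms that])
    show ?thesis using h.hom_zero by simp
  qed
  then show ?case using zero[OF \<iota>_hom] zero[OF \<kappa>_hom] assms(2) by simp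
next
  case (insert x F)
  then show ?case using assms(2) by (simp add: \<iota>_mem(3) \<kappa>_mem(3) L.l_distr)
qed

lemma R_face_conv:
  assumes "face_edges \<rho> d = e # es" "es \<noteq> []"
  shows "R_face \<rho> d = scalar (qpow (- 1)) + (X (edge_vec e) +
    (\<Sum>k\<in>{1..<length es}. X (edge_vec e + edge_sum (take k es))))"
proof -
  obtain m where m: "length es = Suc m" using assms(2) by (cases es) auto
  have "(\<Sum>k\<in>{1..<length (e # es)}. X (edge_sum (take k (e # es))))
      = (\<Sum>k\<in>{Suc 0..<Suc (length es)}. X (edge_sum (take k (e # es))))" by simp
  also have "\<dots> = (\<Sum>k\<in>{0..<Suc m}. X (edge_vec e + edge_sum (take k es)))"
    unfolding sum.shift_bounds_Suc_ivl m by simp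
  also have "\<dots> = X (edge_vec e) + (\<Sum>k\<in>{1..<length es}. X (edge_vec e + edge_sum (take k es)))"
    by (subst sum.atLeast_Suc_lessThan) (simp_all add: m)
  finally show ?thesis by (simp add: R_face_def assms(1))
qed

lemma \<kappa>_diff_scalar: "\<kappa> x = \<iota> x' \<Longrightarrow> \<kappa> (x - scalar s) = \<iota> (x' - scalar s)"
  using \<kappa>_mem(3)[of x "scalar (- s)"] \<iota>_mem(3)[of x' "scalar (- s)"] \<kappa>_scalar[of "- s"]
  by (simp add: monomial_def single_uminus)

text \<open>\<open>c\<close> has pairing -1, \<open>a\<close> has pairing 1, and \<open>bs\<close>
  avoids the flip. Hence all proper partial sums acquire the same right factor, the inverse of
  \<open>binom (- 1)\<close>, and the full sum acquires none.\<close>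

lemma shrinking_face:
  assumes "face_edges \<sigma> d = e\<^sub>0 # c # bs @ [a]" "face_edges \<sigma>' d' = c # bs @ [a]"
    and "distinct bs" "set bs \<inter> E\<^sub>0 = {}" "c = e\<^sub>4 \<and> a = e\<^sub>1 \<or> c = e\<^sub>2 \<and> a = e\<^sub>3"
  shows "\<kappa> (face_relation \<sigma>' d') = \<iota> (face_relation \<sigma> d)"
    and "\<iota> (binom 1) \<otimes> \<kappa> (R_face \<sigma>' d') = \<iota> (R_face \<sigma> d)"
proof -
  define es where "es = c # bs @ [a]"
  have fe: "face_edges \<sigma> d = e\<^sub>0 # es" "face_edges \<sigma>' d' = es" and ne: "es \<noteq> []"
    using assms by (simp_all add: es_def)
  have dist: "distinct es" using assms distinct_edges by (auto simp: es_def)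
  have full: "pairing (edge_sum es) = 0" "trop (edge_sum es) = edge_vec e\<^sub>0 + edge_sum es" "mutates (edge_sum es)"
  proof -
    show "pairing (edge_sum es) = 0"
      unfolding pairing_def lookup_edge_sum[OF dist] using assms(4,5) distinct_edges by (auto simp: es_def)
    show "trop (edge_sum es) = edge_vec e\<^sub>0 + edge_sum es"
      by (rule poly_mapping_eqI, simp only: lookup_trop lookup_add lookup_edge_vec lookup_edge_sum[OF dist])
        (use assms(4,5) distinct_edges in \<open>auto simp: es_def\<close>)
    show "mutates (edge_sum es)"
      by (rule mutates_edge_sum[OF dist]) (use assms(4,5) distinct_edges in \<open>auto simp: es_def\<close>)
  qed
  then show "\<kappa> (face_relation \<sigma>' d') = \<iota> (face_relation \<sigma> d)"
    unfolding face_relation_def fe by (intro \<kappa>_diff_scalar) (simp add: mutates_def dilog_def)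
  let ?K = "{1..<length es}" and ?S = "\<lambda>k. edge_sum (take k es)"
  define T where "T = (\<Sum>k\<in>?K. X (edge_vec e\<^sub>0 + ?S k))"
  have prefix: "pairing (?S k) = - 1" "trop (?S k) = edge_vec e\<^sub>0 + ?S k" "mutates (?S k)" if k: "k \<in> ?K" for k
  proof -
    \<comment> \<open>As \<open>k\<close> is less than \<open>length es\<close>, the last edge
      \<open>a\<close> is not reached.\<close>
    have S: "take k es = c # take (k - 1) bs" and dist': "distinct (c # take (k - 1) bs)"
      using k distinct_take[OF dist, of k] by (auto simp: es_def take_Cons')
    have bs: "set (take (k - 1) bs) \<inter> E\<^sub>0 = {}" using assms(4) set_take_subset by fastforce
    show "pairing (?S k) = - 1"
      unfolding pairing_def S lookup_edge_sum[OF dist'] using bs assms(5) distinct_edges by auto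
    show "trop (?S k) = edge_vec e\<^sub>0 + ?S k"
      by (rule poly_mapping_eqI, simp only: S lookup_trop lookup_add lookup_edge_vec lookup_edge_sum[OF dist'])
        (use bs assms(5) distinct_edges in auto)
    show "mutates (?S k)"
      unfolding S by (rule mutates_edge_sum[OF dist']) (use bs assms(5) distinct_edges in auto)
  qed
  have R: "R_face \<sigma> d = scalar (qpow (- 1)) + (X (edge_vec e\<^sub>0) + T)"
    unfolding T_def using fe(1) ne by (rule R_face_conv)
  have R': "R_face \<sigma>' d' = scalar (qpow (- 1)) + (\<Sum>k\<in>?K. X (?S k))"
    by (simp add: R_face_def fe)
  have \<kappa>T: "\<kappa> (\<Sum>k\<in>?K. X (?S k)) = \<iota> T \<otimes> inv (\<iota> (binom (- 1)))"
    unfolding T_def using binom_Units[of "- 1"] prefix by (intro \<kappa>_sum) (auto simp: mutates_def dilog_def)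
  \<comment> \<open>Moving \<open>binom 1\<close> past monomials of pairing -1 turns it into
    \<open>binom (- 1)\<close>, which will cancel the inverse coming from the mutation.\<close>
  have "torus_mult \<sigma> (binom 1) T = torus_mult \<sigma> T (binom (- 1))"
    unfolding T_def torus_mult_sum_left torus_mult_sum_right
  proof (rule sum.cong[OF refl])
    fix k assume "k \<in> ?K"
    then have "pairing (edge_vec e\<^sub>0 + ?S k) = - 1" using prefix pairing_trop by metis
    then show "torus_mult \<sigma> (binom 1) (X (edge_vec e\<^sub>0 + ?S k)) = torus_mult \<sigma> (X (edge_vec e\<^sub>0 + ?S k)) (binom (- 1))"
      using binom_comm[of 1 "edge_vec e\<^sub>0 + ?S k"] by simp
  qed
  then have T: "\<iota> (binom 1) \<otimes> \<iota> T = \<iota> T \<otimes> \<iota> (binom (- 1))" by (simp add: \<iota>_mem(2)[symmetric])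
  \<comment> \<open>The constant term supplies the additional partial sum
    \<open>X (edge_vec e\<^sub>0)\<close> of the longer face.\<close>
  have c: "torus_mult \<sigma> (binom 1) (scalar (qpow (- 1))) = scalar (qpow (- 1)) + X (edge_vec e\<^sub>0)"
    unfolding binom_def torus_mult_add_left torus_mult_monomial by (simp add: qpow_simps)
  have "\<iota> (binom 1) \<otimes> \<kappa> (R_face \<sigma>' d') =
      \<iota> (binom 1) \<otimes> \<iota> (scalar (qpow (- 1))) \<oplus> \<iota> (binom 1) \<otimes> \<iota> T \<otimes> inv (\<iota> (binom (- 1)))"
    unfolding R' \<kappa>_mem(3) \<kappa>T \<kappa>_scalar using binom_Units[of "- 1"] by (simp add: L.r_distr L.m_assoc)
  also have "\<iota> (binom 1) \<otimes> \<iota> T \<otimes> inv (\<iota> (binom (- 1))) = \<iota> T"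
    unfolding T using binom_Units[of "- 1"] by (simp add: L.m_assoc)
  also have "\<iota> (binom 1) \<otimes> \<iota> (scalar (qpow (- 1))) \<oplus> \<iota> T = \<iota> (R_face \<sigma> d)"
    unfolding R \<iota>_mem(2)[symmetric] \<iota>_mem(3)[symmetric] c by (simp add: add.assoc)
  finally show "\<iota> (binom 1) \<otimes> \<kappa> (R_face \<sigma>' d') = \<iota> (R_face \<sigma> d)" .
qed

text \<open>The signs are opposite to those in \<open>shrinking_face\<close>: proper partial sums
  have pairing 1 and acquire the right factor \<open>binom 1\<close>, while the unit now stands on
  the side of \<open>\<Gamma>\<close>.\<close>

lemma growing_face:
  assumes "face_edges \<sigma> d = c # bs @ [a]" "face_edges \<sigma>' d' = e\<^sub>0 # c # bs @ [a]"
    and "distinct bs" "set bs \<inter> E\<^sub>0 = {}" "c = e\<^sub>1 \<and> a = e\<^sub>2 \<or> c = e\<^sub>3 \<and> a = e\<^sub>4"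
  shows "\<kappa> (face_relation \<sigma>' d') = \<iota> (face_relation \<sigma> d)"
    and "\<kappa> (R_face \<sigma>' d') = \<iota> (X 0 + monomial (qpow 1) (- edge_vec e\<^sub>0)) \<otimes> \<iota> (R_face \<sigma> d)"
proof -
  define es where "es = c # bs @ [a]"
  have fe: "face_edges \<sigma> d = es" "face_edges \<sigma>' d' = e\<^sub>0 # es" and ne: "es \<noteq> []"
    using assms by (simp_all add: es_def)
  have dist: "distinct (e\<^sub>0 # es)" using assms distinct_edges by (auto simp: es_def)
  have "pairing (edge_sum (e\<^sub>0 # es)) = 0" "trop (edge_sum (e\<^sub>0 # es)) = edge_sum es" "mutates (edge_sum (e\<^sub>0 # es))"
  proof -
    have dist': "distinct es" using dist by simp
    show "pairing (edge_sum (e\<^sub>0 # es)) = 0"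
      unfolding pairing_def lookup_edge_sum[OF dist] using assms(4,5) distinct_edges by (auto simp: es_def)
    show "trop (edge_sum (e\<^sub>0 # es)) = edge_sum es"
      by (rule poly_mapping_eqI, simp only: lookup_trop lookup_edge_sum[OF dist] lookup_edge_sum[OF dist'])
        (use assms(4,5) distinct_edges in \<open>auto simp: es_def\<close>)
    show "mutates (edge_sum (e\<^sub>0 # es))"
      by (rule mutates_edge_sum[OF dist]) (use assms(4,5) distinct_edges in \<open>auto simp: es_def\<close>)
  qed
  then show "\<kappa> (face_relation \<sigma>' d') = \<iota> (face_relation \<sigma> d)"
    unfolding face_relation_def fe by (intro \<kappa>_diff_scalar) (simp add: mutates_def dilog_def)
  let ?K = "{1..<length es}" and ?S = "\<lambda>k. edge_sum (take k es)" and ?W = "X 0 + monomial (qpow 1) (- edge_vec e\<^sub>0)"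
  define T where "T = (\<Sum>k\<in>?K. X (?S k - edge_vec e\<^sub>0))"
  have prefix: "pairing (edge_vec e\<^sub>0 + ?S k) = 1" "trop (edge_vec e\<^sub>0 + ?S k) = ?S k - edge_vec e\<^sub>0"
    "mutates (edge_vec e\<^sub>0 + ?S k)" "pairing (?S k) = 1" if k: "k \<in> ?K" for k
  proof -
    have S: "edge_vec e\<^sub>0 + ?S k = edge_sum (e\<^sub>0 # c # take (k - 1) bs)"
      and S': "?S k = edge_sum (c # take (k - 1) bs)"
      using k by (auto simp: es_def take_Cons')
    have bs: "set (take (k - 1) bs) \<inter> E\<^sub>0 = {}" using assms(4) set_take_subset by fastforce
    have dist: "distinct (e\<^sub>0 # c # take (k - 1) bs)"
      using assms(3,5) bs distinct_edges by auto
    then have dist': "distinct (c # take (k - 1) bs)" by simp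
    show "pairing (edge_vec e\<^sub>0 + ?S k) = 1" "pairing (?S k) = 1"
      unfolding pairing_def S lookup_edge_sum[OF dist] unfolding S' lookup_edge_sum[OF dist']
      using bs assms(5) distinct_edges by auto
    have "trop (edge_vec e\<^sub>0 + ?S k) + edge_vec e\<^sub>0 = ?S k"
      unfolding S S'
      by (rule poly_mapping_eqI, simp only: lookup_trop lookup_add lookup_edge_vec lookup_edge_sum[OF dist] lookup_edge_sum[OF dist'])
        (use bs assms(5) distinct_edges in auto)
    then show "trop (edge_vec e\<^sub>0 + ?S k) = ?S k - edge_vec e\<^sub>0" by (simp add: eq_diff_eq)
    show "mutates (edge_vec e\<^sub>0 + ?S k)"
      unfolding S by (rule mutates_edge_sum[OF dist]) (use bs assms(5) distinct_edges in auto)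
  qed
  have R: "R_face \<sigma> d = scalar (qpow (- 1)) + (\<Sum>k\<in>?K. X (?S k))"
    by (simp add: R_face_def fe)
  have R': "R_face \<sigma>' d' = scalar (qpow (- 1)) + (X (edge_vec e\<^sub>0) + (\<Sum>k\<in>?K. X (edge_vec e\<^sub>0 + ?S k)))"
    using fe(2) ne by (rule R_face_conv)
  have \<kappa>T: "\<kappa> (\<Sum>k\<in>?K. X (edge_vec e\<^sub>0 + ?S k)) = \<iota> T \<otimes> \<iota> (binom 1)"
    unfolding T_def using prefix by (intro \<kappa>_sum) (auto simp: mutates_def dilog_def)
  have "torus_mult \<sigma> ?W (\<Sum>k\<in>?K. X (?S k)) = torus_mult \<sigma> T (binom 1)"
    unfolding T_def torus_mult_sum_left torus_mult_sum_right
  proof (rule sum.cong[OF refl])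
    fix k assume k: "k \<in> ?K"
    have "pairing (edge_vec e\<^sub>0) = 0" using distinct_edges by (auto simp: pairing_def lookup_edge_vec)
    then have "form \<sigma> (edge_vec e\<^sub>0) (?S k) = 1" "form \<sigma> (?S k - edge_vec e\<^sub>0) (edge_vec e\<^sub>0) = - 1"
      using prefix(4)[OF k] pairing_add[of "?S k - edge_vec e\<^sub>0" "edge_vec e\<^sub>0"]
      by (simp_all add: form_edge0_left form_edge0_right)
    \<comment> \<open>Both sides equal \<open>X (?S k) + X (?S k - edge_vec e\<^sub>0)\<close>, as
      the form values cancel the coefficient q of either factor.\<close>
    then show "torus_mult \<sigma> ?W (X (?S k)) = torus_mult \<sigma> (X (?S k - edge_vec e\<^sub>0)) (binom 1)"
      unfolding binom_def torus_mult_add_left torus_mult_add_right torus_mult_monomial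
      by (simp add: qpow_simps form_minus_left add.commute)
  qed
  \<comment> \<open>The second term is the image under \<open>\<kappa>\<close> of
    \<open>X (edge_vec e\<^sub>0)\<close>, the first partial sum of the longer face.\<close>
  moreover have "torus_mult \<sigma> ?W (scalar (qpow (- 1))) = scalar (qpow (- 1)) + X (- edge_vec e\<^sub>0)"
    unfolding torus_mult_add_left torus_mult_monomial by (simp add: qpow_simps)
  ultimately have "torus_mult \<sigma> ?W (R_face \<sigma> d) = scalar (qpow (- 1)) + (X (- edge_vec e\<^sub>0) + torus_mult \<sigma> T (binom 1))"
    unfolding R torus_mult_add_right by (simp add: add.assoc)
  from arg_cong[OF this, of \<iota>]
  have "\<iota> ?W \<otimes> \<iota> (R_face \<sigma> d) = \<iota> (scalar (qpow (- 1)) + (X (- edge_vec e\<^sub>0) + torus_mult \<sigma> T (binom 1)))"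
    by (simp only: \<iota>_mem(2))
  also have "\<dots> = \<iota> (scalar (qpow (- 1))) \<oplus> (\<iota> (X (- edge_vec e\<^sub>0)) \<oplus> \<iota> T \<otimes> \<iota> (binom 1))"
    by (simp only: \<iota>_mem(2,3))
  finally show "\<kappa> (R_face \<sigma>' d') = \<iota> ?W \<otimes> \<iota> (R_face \<sigma> d)"
    unfolding R' \<kappa>_mem(3) \<kappa>T \<kappa>_scalar \<kappa>_edges by simp
qed

lemma unchanged_face:
  assumes "face_edges \<sigma>' d' = face_edges \<sigma> d" "distinct (face_edges \<sigma> d)" "set (face_edges \<sigma> d) \<inter> E\<^sub>0 = {}"
  shows "\<kappa> (face_relation \<sigma>' d') = \<iota> (face_relation \<sigma> d)"
    and "\<kappa> (R_face \<sigma>' d') = \<iota> (R_face \<sigma> d)"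
proof -
  let ?es = "face_edges \<sigma> d"
  have \<kappa>: "\<kappa> (X (edge_sum (take k ?es))) = \<iota> (X (edge_sum (take k ?es)))" for k
  proof -
    let ?fs = "take k ?es"
    have dist: "distinct ?fs" using assms(2) by simp
    have fs: "set ?fs \<inter> E\<^sub>0 = {}" using assms(3) set_take_subset by fastforce
    have "pairing (edge_sum ?fs) = 0" unfolding pairing_def lookup_edge_sum[OF dist] using fs by auto
    moreover have "trop (edge_sum ?fs) = edge_sum ?fs"
      by (rule poly_mapping_eqI, simp only: lookup_trop lookup_edge_sum[OF dist]) (use fs in auto)
    moreover have "mutates (edge_sum ?fs)" by (rule mutates_edge_sum[OF dist]) (use fs in auto)
    ultimately show ?thesis by (simp add: mutates_def dilog_def)
  qed
  show "\<kappa> (face_relation \<sigma>' d') = \<iota> (face_relation \<sigma> d)"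
    using \<kappa>[of "length ?es"] unfolding face_relation_def assms(1) by (intro \<kappa>_diff_scalar) simp
  have "\<kappa> (\<Sum>k\<in>{1..<length ?es}. X (edge_sum (take k ?es))) =
      \<iota> (\<Sum>k\<in>{1..<length ?es}. X (edge_sum (take k ?es))) \<otimes> \<one>"
    by (rule \<kappa>_sum) (simp_all add: \<kappa>)
  then show "\<kappa> (R_face \<sigma>' d') = \<iota> (R_face \<sigma> d)"
    unfolding R_face_def assms(1) \<kappa>_mem(3) \<iota>_mem(3) \<kappa>_scalar by simp
qed

text \<open>The set of all edges contains both \<open>e\<^sub>1\<close> and
  \<open>e\<^sub>3\<close>, which \<open>mutates_edge_sum\<close> excludes. It is cut into three
  pieces of pairing 0 that meet that condition, and \<open>mutates_add\<close> joins them.\<close>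

lemma \<kappa>_total_relation: "\<kappa> (total_relation g) = \<iota> (total_relation g)"
proof -
  obtain es where es: "set es = - E\<^sub>0" "distinct es" using finite_distinct_list[of "- E\<^sub>0"] by auto
  let ?a = "edge_sum [e\<^sub>1, e\<^sub>2]" and ?b = "edge_sum [e\<^sub>3, e\<^sub>4]" and ?c = "edge_sum (e\<^sub>0 # es)"
  let ?s = "\<Sum>e\<in>UNIV. edge_vec (e :: 'a)"
  have dist: "distinct [e\<^sub>1, e\<^sub>2]" "distinct [e\<^sub>3, e\<^sub>4]" "distinct (e\<^sub>0 # es)"
    using distinct_edges es(2) by (auto simp: es(1))
  have s: "Poly_Mapping.lookup ?s e = 1" for e
    by (simp add: lookup_sum lookup_edge_vec)
  have eq: "?s = ?a + (?b + ?c)"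
  proof (rule poly_mapping_eqI, simp only: s lookup_add dist[THEN lookup_edge_sum])
    fix e
    consider "e = e\<^sub>0" | "e = e\<^sub>1" | "e = e\<^sub>2" | "e = e\<^sub>3" | "e = e\<^sub>4" | "e \<notin> E\<^sub>0" by auto
    then show "1 = (if e \<in> set [e\<^sub>1, e\<^sub>2] then 1 else 0) + ((if e \<in> set [e\<^sub>3, e\<^sub>4] then 1 else 0) +
        (if e \<in> set (e\<^sub>0 # es) then 1 else (0::int)))"
      using distinct_edges by cases (auto simp: es(1))
  qed
  have "pairing ?a = 0" "pairing ?b = 0" "pairing ?c = 0"
    unfolding pairing_def dist[THEN lookup_edge_sum] using distinct_edges by (auto simp: es(1))
  moreover have "mutates ?a" by (rule mutates_edge_sum) (use distinct_edges in auto)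
  moreover have "mutates ?b" by (rule mutates_edge_sum) (use distinct_edges in auto)
  moreover have "mutates ?c" by (rule mutates_edge_sum[OF dist(3)]) (use distinct_edges in \<open>auto simp: es(1)\<close>)
  ultimately have "mutates ?s" "pairing ?s = 0" unfolding eq by (auto simp only: pairing_add intro!: mutates_add)
  moreover have "trop ?s = ?s" by (rule poly_mapping_eqI) (simp add: lookup_trop s)
  ultimately have "\<kappa> (X ?s) = \<iota> (X ?s)" by (simp add: mutates_def dilog_def)
  then show ?thesis unfolding total_relation_def by (rule \<kappa>_diff_scalar)
qed

section \<open>Comparison of the generated left ideals\<close>

definition face_in :: "'b set \<Rightarrow> 'a dart \<Rightarrow> bool" where
  "face_in J d \<longleftrightarrow> \<iota> (face_relation \<sigma> d) \<in> J \<and> \<iota> (R_face \<sigma> d) \<in> J"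

definition face_in' :: "'b set \<Rightarrow> 'a dart \<Rightarrow> bool" where
  "face_in' J d \<longleftrightarrow> \<kappa> (face_relation \<sigma>' d) \<in> J \<and> \<kappa> (R_face \<sigma>' d) \<in> J"

text \<open>Both relations of a face are treated together, since moving its first edge uses both.
  The faces of the two graphs correspond, and for suitable first edges their relations differ by
  left units.\<close>

lemma face_relations_iff:
  assumes J: "left_ideal L J"
  shows "(\<forall>d. face_in J d) \<longleftrightarrow> (\<forall>d. face_in' J d)"
proof -
  note unit = left_ideal_unit_mult_iff[OF L.ring_axioms J]
  have orb: "face_in J d'" if "face_in J d" "d' \<in> orbit \<phi> d" for d d'
    using \<Gamma>.face_relations_orbit[OF L.ring_axioms \<iota>_hom J] that unfolding face_in_def by blast
  have orb': "face_in' J d'" if "face_in' J d" "d' \<in> orbit \<phi>' d" for d d'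
    using \<Gamma>'.face_relations_orbit[OF L.ring_axioms \<kappa>_hom J] that unfolding face_in'_def by blast
  \<comment> \<open>Quarter turns give the other faces at the flipped edge; the first and the third
    exchange the two graphs.\<close>
  interpret f1: flip \<sigma>' \<sigma> t b r l d\<^sub>4 d\<^sub>1 d\<^sub>2 d\<^sub>3 by (rule flip_quarter_turn)
  interpret f2: flip \<sigma> \<sigma>' r l b t d\<^sub>3 d\<^sub>4 d\<^sub>1 d\<^sub>2 by (rule f1.flip_quarter_turn)
  interpret f3: flip \<sigma>' \<sigma> b t l r d\<^sub>2 d\<^sub>3 d\<^sub>4 d\<^sub>1 by (rule f2.flip_quarter_turn)
  have e0: "fst r = e\<^sub>0" "fst t = e\<^sub>0" "fst b = e\<^sub>0" using r b fst_t by simp_all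
  \<comment> \<open>The top, bottom, left and right face, in this order; the first two lose
    \<open>e\<^sub>0\<close>, the other two gain it.\<close>
  have 0: "face_in J l \<longleftrightarrow> face_in' J d\<^sub>4"
  proof (rule top_face)
    fix es assume "face_edges \<sigma> l = e\<^sub>0 # e\<^sub>4 # es @ [e\<^sub>1]" "face_edges \<sigma>' d\<^sub>4 = e\<^sub>4 # es @ [e\<^sub>1]"
      "distinct es" "set es \<inter> E\<^sub>0 = {}"
    note eq = shrinking_face[OF this]
    show ?thesis using eq unit[OF binom_Units[of 1], of "\<kappa> (R_face \<sigma>' d\<^sub>4)"] by (simp add: face_in_def face_in'_def)
  qed
  have 1: "face_in J r \<longleftrightarrow> face_in' J d\<^sub>2"
  proof (rule f2.top_face)
    fix es assume "face_edges \<sigma> r = fst r # e\<^sub>2 # es @ [e\<^sub>3]" "face_edges \<sigma>' d\<^sub>2 = e\<^sub>2 # es @ [e\<^sub>3]"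
      "distinct es" "set es \<inter> f2.E\<^sub>0 = {}"
    note eq = shrinking_face[of r e\<^sub>2 es e\<^sub>3 d\<^sub>2] this
    show ?thesis using eq unit[OF binom_Units[of 1], of "\<kappa> (R_face \<sigma>' d\<^sub>2)"] 
      by (simp add: face_in_def face_in'_def e0)
  qed
  have 2: "face_in J d\<^sub>1 \<longleftrightarrow> face_in' J b"
  proof (rule f3.top_face)
    fix es assume "face_edges \<sigma>' b = fst b # e\<^sub>1 # es @ [e\<^sub>2]" "face_edges \<sigma> d\<^sub>1 = e\<^sub>1 # es @ [e\<^sub>2]"
      "distinct es" "set es \<inter> f3.E\<^sub>0 = {}"
    note eq = growing_face[of d\<^sub>1 e\<^sub>1 es e\<^sub>2 b] this
    show ?thesis using eq unit[OF binom_neg_Units, of "\<iota> (R_face \<sigma> d\<^sub>1)"] 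
      by (simp add: face_in_def face_in'_def e0)
  qed
  have 3: "face_in J d\<^sub>3 \<longleftrightarrow> face_in' J t"
  proof (rule f1.top_face)
    fix es assume "face_edges \<sigma>' t = fst t # e\<^sub>3 # es @ [e\<^sub>4]" "face_edges \<sigma> d\<^sub>3 = e\<^sub>3 # es @ [e\<^sub>4]"
      "distinct es" "set es \<inter> f1.E\<^sub>0 = {}"
    note eq = growing_face[of d\<^sub>3 e\<^sub>3 es e\<^sub>4 t] this
    show ?thesis using eq unit[OF binom_neg_Units, of "\<iota> (R_face \<sigma> d\<^sub>3)"] 
      by (simp add: face_in_def face_in'_def e0)
  qed
  have darts: "x \<in> {l, r, d\<^sub>1, opp d\<^sub>1, d\<^sub>2, opp d\<^sub>2, d\<^sub>3, opp d\<^sub>3, d\<^sub>4, opp d\<^sub>4}" if "fst x \<in> E\<^sub>0" for x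
    using that r by (auto simp: fst_eq_iff_opp)
  \<comment> \<open>In either graph every dart of the five edges lies on one of these four faces, so
    any other face avoids the five edges and is common to both graphs.\<close>
  have mem: "opp d\<^sub>1 \<in> orbit \<phi> l" "d\<^sub>4 \<in> orbit \<phi> l" "opp d\<^sub>1 \<in> orbit \<phi>' d\<^sub>4"
    "opp d\<^sub>3 \<in> orbit \<phi> r" "d\<^sub>2 \<in> orbit \<phi> r" "opp d\<^sub>3 \<in> orbit \<phi>' d\<^sub>2"
    "opp d\<^sub>2 \<in> orbit \<phi>' b" "d\<^sub>1 \<in> orbit \<phi>' b" "opp d\<^sub>2 \<in> orbit \<phi> d\<^sub>1"
    "opp d\<^sub>4 \<in> orbit \<phi>' t" "d\<^sub>3 \<in> orbit \<phi>' t" "opp d\<^sub>4 \<in> orbit \<phi> d\<^sub>3"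
    using top_face f1.top_face f2.top_face f3.top_face by metis+
  have swap: "d \<in> orbit \<phi> x" if "x \<in> orbit \<phi> d" for x d
    using that permutation_self_in_orbit[OF \<Gamma>.permutation_face_step] by (metis orbit_swap)
  have swap': "d \<in> orbit \<phi>' x" if "x \<in> orbit \<phi>' d" for x d
    using that permutation_self_in_orbit[OF \<Gamma>'.permutation_face_step] by (metis orbit_swap)
  show ?thesis
  proof (intro iffI allI)
    fix d assume *: "\<forall>d. face_in J d"
    show "face_in' J d"
    proof (cases "\<exists>x\<in>orbit \<phi>' d. fst x \<in> E\<^sub>0")
      case True
      then obtain x where x: "x \<in> orbit \<phi>' d" "fst x \<in> E\<^sub>0" by blast
      have "face_in' J d\<^sub>4" "face_in' J d\<^sub>2" "face_in' J b" "face_in' J t" using * 0 1 2 3 by blast+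
      then have "face_in' J x" using darts[OF x(2)] mem orb' tb by (elim insertE emptyE) blast+
      then show ?thesis using orb' swap'[OF x(1)] by blast
    next
      case False
      \<comment> \<open>The turned picture exchanges the rotations, which gives the statement for
        orbits of \<open>\<phi>'\<close>.\<close>
      note o = f1.other_face[of d]
      have "face_edges \<sigma> d = face_edges \<sigma>' d" "distinct (face_edges \<sigma>' d)" "set (face_edges \<sigma>' d) \<inter> E\<^sub>0 = {}"
        using o False e0 by auto
      then show ?thesis using unchanged_face[of d d] spec[OF *, of d] by (simp add: face_in_def face_in'_def)
    qed
  next
    fix d assume *: "\<forall>d. face_in' J d"
    show "face_in J d"
    proof (cases "\<exists>x\<in>orbit \<phi> d. fst x \<in> E\<^sub>0")
      case True
      then obtain x where x: "x \<in> orbit \<phi> d" "fst x \<in> E\<^sub>0" by blast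
      have "face_in J l" "face_in J r" "face_in J d\<^sub>1" "face_in J d\<^sub>3" using * 0 1 2 3 by blast+
      then have "face_in J x" using darts[OF x(2)] mem orb by (elim insertE emptyE) blast+
      then show ?thesis using orb swap[OF x(1)] by blast
    next
      case False
      note o = other_face[of d]
      have "face_edges \<sigma>' d = face_edges \<sigma> d" "distinct (face_edges \<sigma> d)" "set (face_edges \<sigma> d) \<inter> E\<^sub>0 = {}"
        using o False by auto
      then show ?thesis using unchanged_face[of d d] spec[OF *, of d] by (simp add: face_in_def face_in'_def)
    qed
  qed
qed

text \<open>A generated left ideal is an intersection of left ideals, so it suffices that both sets
  of generators lie in the same left ideals.\<close>

lemma left_genideal_generators_eq:
  "left_genideal L (\<kappa> ` (range (face_relation \<sigma>') \<union> {total_relation g} \<union> range (R_face \<sigma>'))) =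
   left_genideal L (\<iota> ` (range (face_relation \<sigma>) \<union> {total_relation g} \<union> range (R_face \<sigma>)))"
proof -
  have "\<kappa> ` (range (face_relation \<sigma>') \<union> {total_relation g} \<union> range (R_face \<sigma>')) \<subseteq> J \<longleftrightarrow>
    \<iota> ` (range (face_relation \<sigma>) \<union> {total_relation g} \<union> range (R_face \<sigma>)) \<subseteq> J" if "left_ideal L J" for J
  proof -
    have "\<kappa> ` (range (face_relation \<sigma>') \<union> {total_relation g} \<union> range (R_face \<sigma>')) \<subseteq> J \<longleftrightarrow>
        \<kappa> (total_relation g) \<in> J \<and> (\<forall>d. face_in' J d)"
      by (auto simp: face_in'_def)
    also have "\<dots> \<longleftrightarrow> \<iota> (total_relation g) \<in> J \<and> (\<forall>d. face_in J d)"
      using face_relations_iff[OF that] \<kappa>_total_relation by simp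
    also have "\<dots> \<longleftrightarrow> \<iota> ` (range (face_relation \<sigma>) \<union> {total_relation g} \<union> range (R_face \<sigma>)) \<subseteq> J"
      by (auto simp: face_in_def)
    finally show ?thesis .
  qed
  then show ?thesis unfolding left_genideal_def 
    by (intro arg_cong[where f = Inter] Collect_cong conj_cong refl)
qed

end

theorem theorem4p4:
  fixes g :: nat
    and \<Gamma> \<Gamma>' :: "('e::finite) rotation"
    and e\<^sub>0 e\<^sub>1 e\<^sub>2 e\<^sub>3 e\<^sub>4 :: 'e
    and L :: "('l, 'm) ring_scheme" and \<iota> :: "'e torus \<Rightarrow> 'l"
    and L' :: "('k, 'n) ring_scheme" and \<iota>' :: "'e torus \<Rightarrow> 'k"
    and \<mu>\<^sub>0 :: "'k \<Rightarrow> 'l"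
  assumes "cubic_sphere_graph g \<Gamma>" and "regular_graph \<Gamma>"
    and "cubic_sphere_graph g \<Gamma>'" and "regular_graph \<Gamma>'"
    and "is_flip \<Gamma> \<Gamma>' e\<^sub>0 e\<^sub>1 e\<^sub>2 e\<^sub>3 e\<^sub>4"
    and "is_localization (quantum_torus \<Gamma>) (ore_set \<Gamma> e\<^sub>0) L \<iota>"
    and "is_localization (quantum_torus \<Gamma>') (ore_set \<Gamma>' e\<^sub>0) L' \<iota>'"
    and "is_quantum_mutation L \<iota> L' \<iota>' e\<^sub>0 e\<^sub>1 e\<^sub>2 e\<^sub>3 e\<^sub>4 \<mu>\<^sub>0"
  shows "\<mu>\<^sub>0 ` localized_chromatic_ideal g \<Gamma>' L' \<iota>' = localized_chromatic_ideal g \<Gamma> L \<iota>"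
proof -
  from assms(5) obtain l r t b d\<^sub>1 d\<^sub>2 d\<^sub>3 d\<^sub>4 where
    e: "fst l = e\<^sub>0" "fst d\<^sub>1 = e\<^sub>1" "fst d\<^sub>2 = e\<^sub>2" "fst d\<^sub>3 = e\<^sub>3" "fst d\<^sub>4 = e\<^sub>4" and
    rb: "r = opp l" "b = opp t" "fst t = e\<^sub>0" and
    rot: "\<Gamma> l = d\<^sub>1" "\<Gamma> d\<^sub>1 = d\<^sub>2" "\<Gamma> d\<^sub>2 = l" "\<Gamma> r = d\<^sub>3" "\<Gamma> d\<^sub>3 = d\<^sub>4" "\<Gamma> d\<^sub>4 = r" and
    rot': "\<Gamma>' t = d\<^sub>4" "\<Gamma>' d\<^sub>4 = d\<^sub>1" "\<Gamma>' d\<^sub>1 = t" "\<Gamma>' b = d\<^sub>2" "\<Gamma>' d\<^sub>2 = d\<^sub>3" "\<Gamma>' d\<^sub>3 = b" and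
    rest: "\<forall>d. d \<notin> {l, r, d\<^sub>1, d\<^sub>2, d\<^sub>3, d\<^sub>4} \<longrightarrow> \<Gamma>' d = \<Gamma> d" and
    dist: "distinct [e\<^sub>0, e\<^sub>1, e\<^sub>2, e\<^sub>3, e\<^sub>4]"
    unfolding is_flip_def by blast
  note mut = assms(8)[unfolded is_quantum_mutation_def Let_def]
  have iso: "\<mu>\<^sub>0 \<in> ring_iso L' L" using mut by blast
  have ring: "ring L" "ring L'" and \<iota>: "\<iota> \<in> ring_hom (quantum_torus \<Gamma>) L" "\<iota>' \<in> ring_hom (quantum_torus \<Gamma>') L'"
    and ore: "\<And>s. s \<in> ore_set \<Gamma> e\<^sub>0 \<Longrightarrow> \<iota> s \<in> Units L"
    using assms(6,7) unfolding is_localization_def by blast+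
  have \<kappa>: "\<mu>\<^sub>0 \<circ> \<iota>' \<in> ring_hom (quantum_torus \<Gamma>') L"
    using ring_hom_trans[OF \<iota>(2)] iso by (auto simp: ring_iso_def)
  interpret flip_mutation \<Gamma> \<Gamma>' l r t b d\<^sub>1 d\<^sub>2 d\<^sub>3 d\<^sub>4 L \<iota> "\<mu>\<^sub>0 \<circ> \<iota>'"
  proof (intro flip_mutation.intro flip.intro cubic_regular.intro flip_axioms.intro flip_mutation_axioms.intro)
    show "\<Gamma> (\<Gamma> (\<Gamma> d)) = d" "\<Gamma>' (\<Gamma>' (\<Gamma>' d)) = d" for d
      using assms(1,3) unfolding cubic_sphere_graph_def by blast+
    show "\<Gamma>' d = \<Gamma> d" if "d \<notin> {l, r, d\<^sub>1, d\<^sub>2, d\<^sub>3, d\<^sub>4}" for d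
      using that rest by blast
    show "\<iota> s \<in> Units L" if "s \<in> ore_set \<Gamma> (fst l)" for s
      using that ore e by simp
    show "(\<mu>\<^sub>0 \<circ> \<iota>') (X (edge_vec e)) = \<iota> (X (edge_vec e))" if "e \<notin> {fst l, fst d\<^sub>1, fst d\<^sub>2, fst d\<^sub>3, fst d\<^sub>4}" for e
      using that mut e by simp
    show "\<iota> \<in> ring_hom (quantum_torus \<Gamma>) L" "\<mu>\<^sub>0 \<circ> \<iota>' \<in> ring_hom (quantum_torus \<Gamma>') L" "ring L"
      by (fact \<iota> \<kappa> ring)+
  qed (use assms(2,4) e rb rot rot' dist mut in simp_all)
  let ?gens' = "range (face_relation \<Gamma>') \<union> {total_relation g} \<union> range (R_face \<Gamma>')"
  \<comment> \<open>The localized ideal is generated by the images of the three families, and the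
    isomorphism \<open>\<mu>\<^sub>0\<close> carries generated left ideals to generated left
    ideals.\<close>
  have "\<mu>\<^sub>0 ` localized_chromatic_ideal g \<Gamma>' L' \<iota>' = left_genideal L (\<mu>\<^sub>0 ` \<iota>' ` ?gens')"
    unfolding localized_chromatic_ideal_def left_genideal_image_chromatic_ideal[OF ring(2) \<iota>(2)]
    using ring_hom_memE(1)[OF \<iota>(2)] by (intro ring_iso_image_left_genideal[OF ring(2,1) iso]) auto
  also have "\<dots> = localized_chromatic_ideal g \<Gamma> L \<iota>"
    unfolding localized_chromatic_ideal_def left_genideal_image_chromatic_ideal[OF ring(1) \<iota>(1)]
    using left_genideal_generators_eq[of g] by (simp only: image_comp)
  finally show ?thesis .
qed

end
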